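(* Let $p$ be an odd prime and let $n>1$ be an integer. Let $\omega_D\in H^3(V_{2n+1},k^\times)\cong\bigwedge^3(V_{2n+1}^* )\oplus\mathsf{S}^2(V_{2n+1}^* )$ be the class $$\omega_D=\Big(x_0\wedge\sum_{i=1}^n x_{2i-1}\wedge x_{2i},\;0\Big).$$ Then $$\mathsf{Stab}(\omega_D)\cong AffSp_{2n}(\mathbb{F}_p)\rtimes\mathbb{F}_p^\times .$$
   Context: $k$ is an algebraically closed field of characteristic $0$. $V_{2n+1}$ is the elementary abelian $p$-group of order $p^{2n+1}$, viewed as a vector space over $\mathbb{F}_p$ with coordinate functions $x_0,x_1,\dots,x_{2n}$ forming a basis of $V_{2n+1}^*=\mathrm{Hom}(V_{2n+1},\mathbb{F}_p)$. The isomorphism $H^3(V_{2n+1},k^\times)\cong\bigwedge^3(V_{2n+1}^* )\oplus\mathsf{S}^2(V_{2n+1}^* )$ is one of $GL_{2n+1}(\mathbb{F}_p)$-modules, under which $x_i\wedge x_j\wedge x_l$ corresponds to the class of the cocycle $(u,v,w)\mapsto\xi^{u_iv_jw_l}$ for a fixed primitive $p$-th root of unity $\xi\in k$. (The class $\omega_D$ arises from the extra special group $D$ of order $p^{2n+1}$ and exponent $p$ through a braided equivalence $\mathcal{Z}(\mathsf{Vec}_D)\cong\mathcal{Z}(\mathcal{C}(V_{2n+1},\omega_D))$.) $\mathsf{Stab}(\omega)\subset GL_{2n+1}(\mathbb{F}_p)$ is the subgroup of automorphisms $a$ of $V_{2n+1}$ such that $\omega\circ(a\times a\times a)$ is cohomologous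 to $\omega$. $Sp_{2n}(\mathbb{F}_p)$ is the symplectic group. For a subgroup $G\subset GL(V)$, $AffG=V\rtimes G$ is the corresponding affine group; so $AffSp_{2n}(\mathbb{F}_p)=\mathbb{F}_p^{2n}\rtimes Sp_{2n}(\mathbb{F}_p)$. The symbol $\rtimes$ denotes a semidirect product (the statement asserts that the stabilizer is isomorphic to such a semidirect product). *)

theory Defs
  imports
    "HOL-Algebra.Bij"
    "HOL-Algebra.Coset"
    "Jordan_Normal_Form.Matrix"
    "Jordan_Normal_Form.VS_Connect"
    "Berlekamp_Zassenhaus.Finite_Field"
begin

text \<open>
  The prime field of order \<open>p\<close> is \<^typ>\<open>'p mod_ring\<close> with \<^prop>\<open>CARD('p::prime_card) = p\<close>;
  the vector space of dimension \<open>m\<close> over it is \<^term>\<open>monoid_vec TYPE('p::prime_card mod_ring) m\<close>,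
  whose coordinate functions are \<open>\<lambda>u. u $ i\<close> for \<open>i < m\<close>.
\<close>

abbreviation mult_group :: "'a::field itself \<Rightarrow> 'a monoid" where
  "mult_group ty \<equiv> units_of (class_ring :: 'a ring)"

definition GL :: "'a::field itself \<Rightarrow> nat \<Rightarrow> 'a mat monoid" where
  "GL ty m = units_of (ring_mat ty m ())"


subsection \<open>Third cohomology of a group with trivial coefficients\<close>

text \<open>
  Inhomogeneous cochains, made extensional so that equality of cochains is equality of functions.
  The coefficient group \<open>A\<close> is abelian, is written multiplicatively and carries the trivial action.
\<close>

definition Z3 :: "('g, 'b) monoid_scheme \<Rightarrow> ('a, 'c) monoid_scheme \<Rightarrow> ('g \<times> 'g \<times> 'g \<Rightarrow> 'a) monoid"
  where
  "Z3 G A =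
    \<lparr>carrier = {f \<in> carrier G \<times> carrier G \<times> carrier G \<rightarrow>\<^sub>E carrier A.
        \<forall>g\<in>carrier G. \<forall>h\<in>carrier G. \<forall>k\<in>carrier G. \<forall>l\<in>carrier G.
          f (h, k, l) \<otimes>\<^bsub>A\<^esub> f (g, h \<otimes>\<^bsub>G\<^esub> k, l) \<otimes>\<^bsub>A\<^esub> f (g, h, k)
            = f (g \<otimes>\<^bsub>G\<^esub> h, k, l) \<otimes>\<^bsub>A\<^esub> f (g, h, k \<otimes>\<^bsub>G\<^esub> l)},
     monoid.mult = (\<lambda>f f'. \<lambda>x\<in>carrier G \<times> carrier G \<times> carrier G. f x \<otimes>\<^bsub>A\<^esub> f' x),
     monoid.one = (\<lambda>x\<in>carrier G \<times> carrier G \<times> carrier G. \<one>\<^bsub>A\<^esub>)\<rparr>"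

definition coboundary2 ::
  "('g, 'b) monoid_scheme \<Rightarrow> ('a, 'c) monoid_scheme \<Rightarrow> ('g \<times> 'g \<Rightarrow> 'a) \<Rightarrow> ('g \<times> 'g \<times> 'g \<Rightarrow> 'a)"
  where
  "coboundary2 G A f = (\<lambda>(g, h, k)\<in>carrier G \<times> carrier G \<times> carrier G.
     f (h, k) \<otimes>\<^bsub>A\<^esub> inv\<^bsub>A\<^esub> f (g \<otimes>\<^bsub>G\<^esub> h, k) \<otimes>\<^bsub>A\<^esub> f (g, h \<otimes>\<^bsub>G\<^esub> k) \<otimes>\<^bsub>A\<^esub> inv\<^bsub>A\<^esub> f (g, h))"

definition B3 :: "('g, 'b) monoid_scheme \<Rightarrow> ('a, 'c) monoid_scheme \<Rightarrow> ('g \<times> 'g \<times> 'g \<Rightarrow> 'a) set"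
  where
  "B3 G A = coboundary2 G A ` (carrier G \<times> carrier G \<rightarrow>\<^sub>E carrier A)"

definition H3 ::
  "('g, 'b) monoid_scheme \<Rightarrow> ('a, 'c) monoid_scheme \<Rightarrow> ('g \<times> 'g \<times> 'g \<Rightarrow> 'a) set monoid"
  where
  "H3 G A = Z3 G A Mod B3 G A"

definition pullback3 ::
  "('g, 'b) monoid_scheme \<Rightarrow> ('g \<Rightarrow> 'g) \<Rightarrow> ('g \<times> 'g \<times> 'g \<Rightarrow> 'a) \<Rightarrow> ('g \<times> 'g \<times> 'g \<Rightarrow> 'a)"
  where
  "pullback3 G a f = (\<lambda>(u, v, w)\<in>carrier G \<times> carrier G \<times> carrier G. f (a u, a v, a w))"

text \<open>
  The stabilizer of a cohomology class, that is of a coset of \<^const>\<open>B3\<close>: the two cocycles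
  \<open>\<omega>\<close> and \<open>\<omega> \<circ> (a \<times> a \<times> a)\<close> are cohomologous iff they lie in the same coset.
\<close>

definition Stab ::
  "'a::field itself \<Rightarrow> nat \<Rightarrow> ('a vec \<times> 'a vec \<times> 'a vec \<Rightarrow> 'k) set \<Rightarrow> 'a mat monoid"
  where
  "Stab ty m c = (GL ty m)
     \<lparr>carrier := {a \<in> carrier (GL ty m).
        \<forall>\<omega>\<in>c. pullback3 (monoid_vec ty m) (\<lambda>v. a *\<^sub>v v) \<omega> \<in> c}\<rparr>"


subsection \<open>The class \<open>\<omega>\<^sub>D\<close>\<close>

text \<open>
  The image of \<open>x\<^sub>i \<and> x\<^sub>j \<and> x\<^sub>l\<close> under the embedding of the third exterior power of the dual
  space into the third cohomology group is the class of \<open>(u, v, w) \<mapsto> \<xi> ^ (u\<^sub>i v\<^sub>j w\<^sub>l)\<close>.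
  The exponent is a residue class modulo \<open>p\<close>; the choice of its representative is immaterial
  as \<open>\<xi> ^ p = 1\<close>.
\<close>

definition wedge_cocycle ::
  "nat \<Rightarrow> 'k::field \<Rightarrow> nat \<Rightarrow> nat \<Rightarrow> nat
    \<Rightarrow> ('p::prime_card mod_ring vec \<times> 'p mod_ring vec \<times> 'p mod_ring vec \<Rightarrow> 'k)"
  where
  "wedge_cocycle m \<xi> i j l =
    (\<lambda>(u, v, w)\<in>carrier_vec m \<times> carrier_vec m \<times> carrier_vec m.
       \<xi> powi to_int_mod_ring (u $ i * v $ j * w $ l))"

abbreviation H3_vec ::
  "'p::prime_card itself \<Rightarrow> 'k::field itself \<Rightarrow> nat
    \<Rightarrow> ('p mod_ring vec \<times> 'p mod_ring vec \<times> 'p mod_ring vec \<Rightarrow> 'k) set monoid"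
  where
  "H3_vec tp tk m \<equiv> H3 (monoid_vec TYPE('p mod_ring) m) (mult_group tk)"

definition wedge_class ::
  "nat \<Rightarrow> 'k::field \<Rightarrow> nat \<Rightarrow> nat \<Rightarrow> nat
    \<Rightarrow> ('p::prime_card mod_ring vec \<times> 'p mod_ring vec \<times> 'p mod_ring vec \<Rightarrow> 'k) set"
  where
  "wedge_class m \<xi> i j l =
     B3 (monoid_vec TYPE('p mod_ring) m) (mult_group TYPE('k))
       #>\<^bsub>Z3 (monoid_vec TYPE('p mod_ring) m) (mult_group TYPE('k))\<^esub> wedge_cocycle m \<xi> i j l"

text \<open>
  The class of \<open>x\<^sub>0 \<and> (\<Sum>i = 1..n. x\<^bsub>2i-1\<^esub> \<and> x\<^bsub>2i\<^esub>)\<close>, with vanishing component in the symmetric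
  square. The cohomology group is written multiplicatively, so the sum over \<open>i\<close> becomes a product.
\<close>

definition omega_D ::
  "'p::prime_card itself \<Rightarrow> nat \<Rightarrow> 'k::field
    \<Rightarrow> ('p mod_ring vec \<times> 'p mod_ring vec \<times> 'p mod_ring vec \<Rightarrow> 'k) set"
  where
  "omega_D tp n \<xi> =
    (\<Otimes>\<^bsub>H3_vec tp TYPE('k) (2 * n + 1)\<^esub>i\<in>{1..n}. wedge_class (2 * n + 1) \<xi> 0 (2 * i - 1) (2 * i))"


subsection \<open>Semidirect products, the symplectic group and its affine group\<close>

text \<open>
  \<open>G\<close> is the normal factor, and \<open>\<phi> h\<close> is the automorphism of \<open>G\<close> by which \<open>h\<close> acts.
\<close>

definition semidirect ::
  "('g, 'b) monoid_scheme \<Rightarrow> ('h, 'c) monoid_scheme \<Rightarrow> ('h \<Rightarrow> 'g \<Rightarrow> 'g) \<Rightarrow> ('g \<times> 'h) monoid"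
  where
  "semidirect G H \<phi> =
    \<lparr>carrier = carrier G \<times> carrier H,
     monoid.mult = (\<lambda>(g, h) (g', h'). (g \<otimes>\<^bsub>G\<^esub> \<phi> h g', h \<otimes>\<^bsub>H\<^esub> h')),
     monoid.one = (\<one>\<^bsub>G\<^esub>, \<one>\<^bsub>H\<^esub>)\<rparr>"

definition symplectic_form :: "nat \<Rightarrow> 'a::field vec \<Rightarrow> 'a vec \<Rightarrow> 'a" where
  "symplectic_form n u v = (\<Sum>i<n. u $ (2 * i) * v $ (2 * i + 1) - u $ (2 * i + 1) * v $ (2 * i))"

text \<open>The parameter \<open>n\<close> is half the dimension of the symplectic space.\<close>

definition Sp_set :: "'a::field itself \<Rightarrow> nat \<Rightarrow> 'a mat set" where
  "Sp_set ty n = {A \<in> carrier (GL ty (2 * n)).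
     \<forall>u\<in>carrier_vec (2 * n). \<forall>v\<in>carrier_vec (2 * n).
       symplectic_form n (A *\<^sub>v u) (A *\<^sub>v v) = symplectic_form n u v}"

definition Aff :: "'a::field itself \<Rightarrow> nat \<Rightarrow> 'a mat set \<Rightarrow> ('a vec \<times> 'a mat) monoid" where
  "Aff ty m S = semidirect (monoid_vec ty m) ((GL ty m)\<lparr>carrier := S\<rparr>) (\<lambda>A v. A *\<^sub>v v)"

abbreviation AffSp :: "'a::field itself \<Rightarrow> nat \<Rightarrow> ('a vec \<times> 'a mat) monoid" where
  "AffSp ty n \<equiv> Aff ty (2 * n) (Sp_set ty n)"

end

theory Submission
  imports Defs
begin

text \<open>
  The class is represented by \<open>\<xi> ^ T\<close> with \<open>T u v w = u\<^sub>0 * B v w\<close> trilinear, where \<open>B v w\<close> is the sum of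
  the products \<open>v\<^bsub>2i-1\<^esub> * w\<^bsub>2i\<^esub>\<close>. Antisymmetrizing a coboundary over the three arguments gives \<open>1\<close>,
  so a matrix that stabilizes the class preserves the alternating form \<open>\<Phi> = x\<^sub>0 \<and> \<Omega>\<close> obtained from \<open>T\<close>. Conversely, if \<open>\<Phi>\<close> is preserved, then the change of \<open>T\<close> is a sum of
  trilinear forms that are symmetric in two adjacent arguments, and these are coboundaries as \<open>p\<close> is odd.

  For \<open>n > 1\<close> the hyperplane \<open>x\<^sub>0 = 0\<close> is intrinsic to \<open>\<Phi>\<close>: it consists of the vectors whose contraction
  with \<open>\<Phi>\<close> is decomposable. Hence the matrices preserving \<open>\<Phi>\<close> are the block matrices with rows \<open>(c, 0)\<close>
  and \<open>(b, A)\<close> where \<open>A\<close> multiplies \<open>\<Omega>\<close> by \<open>1 / c\<close>. The projection to \<open>c\<close> has kernel the affine symplectic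
  group, and it is split by block diagonal matrices.
\<close>

subsection \<open>Split extensions\<close>

text \<open>Each \<open>e\<close> factors uniquely as an element of the kernel of
  \<open>\<pi>\<close> times \<open>\<sigma> (\<pi> e)\<close>, and \<open>H\<close> acts on the
  kernel by conjugation through \<open>\<sigma>\<close>. The kernel is represented by an embedding
  \<open>\<iota>\<close>, so that \<open>N\<close> can be an external model of it, here later the
  affine group. Of \<open>N\<close> itself only closure is assumed; its group laws are read off in
  \<open>E\<close>.\<close>

lemma split_extension_iso_semidirect:
  fixes E (structure)
  assumes "group E" and "group H"
    and \<pi>: "\<pi> \<in> hom E H" and \<sigma>: "\<sigma> \<in> hom H E"
    and retract: "\<And>h. h \<in> carrier H \<Longrightarrow> \<pi> (\<sigma> h) = h"
    and closed: "\<And>x y. x \<in> carrier N \<Longrightarrow> y \<in> carrier N \<Longrightarrow> x \<otimes>\<^bsub>N\<^esub> y \<in> carrier N"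
    and \<iota>: "\<iota> \<in> hom N E" "inj_on \<iota> (carrier N)" "\<iota> ` carrier N = kernel E H \<pi>"
  shows "\<exists>\<phi> \<in> hom H (AutoGroup N). E \<cong> semidirect N H \<phi>"
proof -
  interpret E: group E by fact
  interpret H: group H by fact
  interpret \<pi>: group_hom E H \<pi> by unfold_locales fact
  interpret \<sigma>: group_hom H E \<sigma> by unfold_locales fact
  define j where "j = inv_into (carrier N) \<iota>"
  \<comment> \<open>The restriction to \<open>carrier N\<close> is there because elements of
    \<open>auto N\<close> are extensional functions.\<close>
  define \<phi> where "\<phi> h = (\<lambda>x\<in>carrier N. j (\<sigma> h \<otimes> \<iota> x \<otimes> inv (\<sigma> h)))" for h
  define F where "F e = (j (e \<otimes> inv (\<sigma> (\<pi> e))), \<pi> e)" for e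
  have \<iota>_closed [simp]: "\<iota> x \<in> carrier E" if "x \<in> carrier N" for x
    using \<iota>(1) that by (auto simp: hom_def)
  have \<iota>_mult: "\<iota> (x \<otimes>\<^bsub>N\<^esub> y) = \<iota> x \<otimes> \<iota> y" if "x \<in> carrier N" "y \<in> carrier N" for x y
    using \<iota>(1) that by (auto simp: hom_def)
  have \<pi>_\<iota> [simp]: "\<pi> (\<iota> x) = \<one>\<^bsub>H\<^esub>" if "x \<in> carrier N" for x
    using \<iota>(3) that by (auto simp: kernel_def)
  \<comment> \<open>By injectivity of \<open>\<iota>\<close>, every identity in \<open>N\<close>
    below is checked in \<open>E\<close>, where the group laws are at hand.\<close>
  have \<iota>_eq: "\<iota> x = \<iota> y \<Longrightarrow> x \<in> carrier N \<Longrightarrow> y \<in> carrier N \<Longrightarrow> x = y" for x y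
    using \<iota>(2) by (auto dest: inj_onD)
  have j: "j e \<in> carrier N" "\<iota> (j e) = e" if "e \<in> carrier E" "\<pi> e = \<one>\<^bsub>H\<^esub>" for e
  proof -
    have "e \<in> \<iota> ` carrier N"
      using that \<iota>(3) by (auto simp: kernel_def)
    then show "j e \<in> carrier N" "\<iota> (j e) = e"
      by (simp_all add: j_def inv_into_into f_inv_into_f)
  qed
  have \<phi>: "\<phi> h x \<in> carrier N" "\<iota> (\<phi> h x) = \<sigma> h \<otimes> \<iota> x \<otimes> inv (\<sigma> h)"
    if "h \<in> carrier H" "x \<in> carrier N" for h x
    using that by (auto simp: \<phi>_def retract intro!: j)
  have \<phi>_mult: "\<phi> (h \<otimes>\<^bsub>H\<^esub> h') x = \<phi> h (\<phi> h' x)"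
    if "h \<in> carrier H" "h' \<in> carrier H" "x \<in> carrier N" for h h' x
    using that by (intro \<iota>_eq) (simp_all add: \<phi> E.inv_mult_group E.m_assoc)
  have \<phi>_one: "\<phi> \<one>\<^bsub>H\<^esub> x = x" if "x \<in> carrier N" for x
    using that by (intro \<iota>_eq) (simp_all add: \<phi>)
  have cancel: "inv x \<otimes> (x \<otimes> y) = y" if "x \<in> carrier E" "y \<in> carrier E" for x y
    using that by (simp flip: E.m_assoc)
  have \<phi>_hom: "\<phi> h (x \<otimes>\<^bsub>N\<^esub> y) = \<phi> h x \<otimes>\<^bsub>N\<^esub> \<phi> h y"
    if "h \<in> carrier H" "x \<in> carrier N" "y \<in> carrier N" for h x y
    using that
    by (intro \<iota>_eq) (simp_all add: \<phi> \<iota>_mult closed E.m_assoc cancel)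
  have \<phi>_bij: "bij_betw (\<phi> h) (carrier N) (carrier N)" if "h \<in> carrier H" for h
    by (rule bij_betw_byWitness[where f' = "\<phi> (inv\<^bsub>H\<^esub> h)"])
      (use that in \<open>auto simp: \<phi> \<phi>_one simp flip: \<phi>_mult\<close>)
  have \<phi>_auto: "\<phi> h \<in> auto N" if "h \<in> carrier H" for h
    using that by (auto simp: auto_def Bij_def hom_def \<phi> \<phi>_hom \<phi>_bij) (simp add: \<phi>_def)
  have "\<phi> \<in> hom H (AutoGroup N)"
  proof (rule homI)
    fix h assume h: "h \<in> carrier H"
    then show "\<phi> h \<in> carrier (AutoGroup N)" by (simp add: AutoGroup_def \<phi>_auto)
    fix h' assume h': "h' \<in> carrier H"
    have "\<phi> (h \<otimes>\<^bsub>H\<^esub> h') = compose (carrier N) (\<phi> h) (\<phi> h')"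
      using h h' by (auto simp: fun_eq_iff compose_def \<phi>_mult) (simp add: \<phi>_def)
    then show "\<phi> (h \<otimes>\<^bsub>H\<^esub> h') = \<phi> h \<otimes>\<^bsub>AutoGroup N\<^esub> \<phi> h'"
      using \<phi>_auto[OF h] \<phi>_auto[OF h'] by (simp add: AutoGroup_def BijGroup_def auto_def)
  qed
  moreover have F1: "e \<otimes> inv (\<sigma> (\<pi> e)) \<in> carrier E" "\<pi> (e \<otimes> inv (\<sigma> (\<pi> e))) = \<one>\<^bsub>H\<^esub>"
    if "e \<in> carrier E" for e
    using that by (simp_all add: retract)
  have "F \<in> iso E (semidirect N H \<phi>)"
  proof (rule isoI)
    show "F \<in> hom E (semidirect N H \<phi>)"
    proof (rule homI)
      fix e assume e: "e \<in> carrier E"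
      then show "F e \<in> carrier (semidirect N H \<phi>)"
        using F1[OF e] by (simp add: F_def semidirect_def j)
      fix e' assume e': "e' \<in> carrier E"
      have "j (e \<otimes> e' \<otimes> inv (\<sigma> (\<pi> (e \<otimes> e'))))
          = j (e \<otimes> inv (\<sigma> (\<pi> e))) \<otimes>\<^bsub>N\<^esub> \<phi> (\<pi> e) (j (e' \<otimes> inv (\<sigma> (\<pi> e'))))"
        using e e' F1[OF e] F1[OF e'] F1[of "e \<otimes> e'"]
        by (intro \<iota>_eq)
          (simp_all add: j \<phi> \<iota>_mult closed E.m_assoc E.inv_mult_group cancel)
      then show "F (e \<otimes> e') = F e \<otimes>\<^bsub>semidirect N H \<phi>\<^esub> F e'"
        using e e' by (simp add: F_def semidirect_def)
    qed
    show "bij_betw F (carrier E) (carrier (semidirect N H \<phi>))"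
    proof (rule bij_betw_byWitness[where f' = "\<lambda>(x, h). \<iota> x \<otimes> \<sigma> h"])
      show "\<forall>e\<in>carrier E. (case F e of (x, h) \<Rightarrow> \<iota> x \<otimes> \<sigma> h) = e"
        using F1 by (simp add: F_def j E.m_assoc)
      show "\<forall>xh\<in>carrier (semidirect N H \<phi>). F (case xh of (x, h) \<Rightarrow> \<iota> x \<otimes> \<sigma> h) = xh"
        by (auto simp: F_def semidirect_def retract E.m_assoc j_def \<iota>(2))
      show "F ` carrier E \<subseteq> carrier (semidirect N H \<phi>)"
        using F1 by (auto simp: F_def semidirect_def j)
      show "(\<lambda>(x, h). \<iota> x \<otimes> \<sigma> h) ` carrier (semidirect N H \<phi>) \<subseteq> carrier E"
        by (auto simp: semidirect_def)
    qed
  qed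
  ultimately show ?thesis by (auto simp: is_iso_def)
qed

subsection \<open>Block matrices\<close>

lemma carrier_GL:
  "a \<in> carrier (GL TYPE('a::field) m) \<longleftrightarrow>
    a \<in> carrier_mat m m \<and> (\<exists>b\<in>carrier_mat m m. b * a = 1\<^sub>m m \<and> a * b = 1\<^sub>m m)"
  by (auto simp: GL_def units_of_def Units_def ring_mat_simps)

lemma mult_GL [simp]: "monoid.mult (GL ty m) = (*)" and one_GL [simp]: "one (GL ty m) = 1\<^sub>m m"
  by (auto simp: GL_def units_of_def ring_mat_simps)

lemma group_GL: "group (GL TYPE('a::field) m)"
proof -
  interpret semiring "ring_mat TYPE('a) m ()" by (rule semiring_mat)
  show ?thesis unfolding GL_def by (rule units_group)
qed

lemma carrier_vec_SucE:
  assumes "v \<in> carrier_vec (Suc d)"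
  obtains x w where "v = vCons x w" "w \<in> carrier_vec d"
  using assms by (cases v) auto

lemma eq_mat_by_mult_vec:
  fixes A B :: "'a::semiring_1 mat"
  assumes "A \<in> carrier_mat m k" "B \<in> carrier_mat m k"
    and "\<And>v. v \<in> carrier_vec k \<Longrightarrow> A *\<^sub>v v = B *\<^sub>v v"
  shows "A = B"
proof (rule eq_matI)
  fix i j assume "i < dim_row B" "j < dim_col B"
  then show "A $$ (i, j) = B $$ (i, j)"
    using assms(1,2) arg_cong[OF assms(3)[of "unit_vec k j"], of "\<lambda>v. v $ i"] by auto
qed (use assms in auto)

text \<open>The shape of a linear map that stabilizes the hyperplane \<open>x_0 = 0\<close>. For
  \<open>c = 1\<close> it acts on the slice \<open>x_0 = 1\<close> as the affine map sending
  \<open>w\<close> to \<open>b + A w\<close>, which is how the affine group arises.\<close>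

definition block_mat :: "nat \<Rightarrow> 'a::field \<Rightarrow> 'a vec \<Rightarrow> 'a mat \<Rightarrow> 'a mat" where
  "block_mat d c b A = mat (Suc d) (Suc d) (\<lambda>(i, j).
     case i of 0 \<Rightarrow> (case j of 0 \<Rightarrow> c | Suc _ \<Rightarrow> 0)
     | Suc i \<Rightarrow> (case j of 0 \<Rightarrow> b $ i | Suc j \<Rightarrow> A $$ (i, j)))"

lemma block_mat_carrier [simp]: "block_mat d c b A \<in> carrier_mat (Suc d) (Suc d)"
  by (simp add: block_mat_def)

lemma block_mat_00 [simp]: "block_mat d c b A $$ (0, 0) = c"
  by (simp add: block_mat_def)

lemma block_mat_mult_vec:
  assumes "b \<in> carrier_vec d" "A \<in> carrier_mat d d" "w \<in> carrier_vec d"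
  shows "block_mat d c b A *\<^sub>v vCons x w = vCons (c * x) (x \<cdot>\<^sub>v b + A *\<^sub>v w)"
proof (rule eq_vecI)
  fix i assume i: "i < dim_vec (vCons (c * x) (x \<cdot>\<^sub>v b + A *\<^sub>v w))"
  have row: "row (block_mat d c b A) i = vCons (case i of 0 \<Rightarrow> c | Suc i \<Rightarrow> b $ i)
      (case i of 0 \<Rightarrow> 0\<^sub>v d | Suc i \<Rightarrow> row A i)"
    using assms i
    by (intro eq_vecI)
      (auto simp: block_mat_def vec_index_vCons split: nat.splits)
  have "(block_mat d c b A *\<^sub>v vCons x w) $ i = row (block_mat d c b A) i \<bullet> vCons x w"
    using assms i by (intro index_mult_mat_vec) (simp add: block_mat_def)
  also have "\<dots> = vCons (c * x) (x \<cdot>\<^sub>v b + A *\<^sub>v w) $ i"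
    unfolding row using assms i by (cases i) simp_all
  finally show "(block_mat d c b A *\<^sub>v vCons x w) $ i = vCons (c * x) (x \<cdot>\<^sub>v b + A *\<^sub>v w) $ i" .
qed (use assms in \<open>auto simp: block_mat_def\<close>)

text \<open>Both sides are compared by their action on vectors \<open>vCons x w\<close>, which
  avoids splitting the sums that define matrix entries.\<close>

lemma block_mat_mult:
  assumes "b \<in> carrier_vec d" "A \<in> carrier_mat d d" "b' \<in> carrier_vec d" "A' \<in> carrier_mat d d"
  shows "block_mat d c b A * block_mat d c' b' A' = block_mat d (c * c') (c' \<cdot>\<^sub>v b + A *\<^sub>v b') (A * A')"
proof (rule eq_mat_by_mult_vec[where m = "Suc d" and k = "Suc d"])
  fix v :: "'a vec" assume v: "v \<in> carrier_vec (Suc d)"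
  then obtain x w where [simp]: "v = vCons x w" and w: "w \<in> carrier_vec d" by (rule carrier_vec_SucE)
  have "block_mat d c b A * block_mat d c' b' A' *\<^sub>v v = block_mat d c b A *\<^sub>v (block_mat d c' b' A' *\<^sub>v v)"
    by (rule assoc_mult_mat_vec[OF block_mat_carrier block_mat_carrier v])
  also have "\<dots> = vCons (c * (c' * x)) ((c' * x) \<cdot>\<^sub>v b + A *\<^sub>v (x \<cdot>\<^sub>v b' + A' *\<^sub>v w))"
    using assms w by (simp add: block_mat_mult_vec)
  also have "A *\<^sub>v (x \<cdot>\<^sub>v b' + A' *\<^sub>v w) = x \<cdot>\<^sub>v (A *\<^sub>v b') + (A * A') *\<^sub>v w"
    using assms w by (simp add: mult_add_distrib_mat_vec[of _ d d] mult_mat_vec[of _ d d])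
  also have "(c' * x) \<cdot>\<^sub>v b + (x \<cdot>\<^sub>v (A *\<^sub>v b') + (A * A') *\<^sub>v w)
      = x \<cdot>\<^sub>v (c' \<cdot>\<^sub>v b + A *\<^sub>v b') + (A * A') *\<^sub>v w"
    using assms w by (intro eq_vecI) (auto simp: algebra_simps simp del: index_mult_mat_vec)
  finally show "block_mat d c b A * block_mat d c' b' A' *\<^sub>v v
      = block_mat d (c * c') (c' \<cdot>\<^sub>v b + A *\<^sub>v b') (A * A') *\<^sub>v v"
    using assms w by (simp add: block_mat_mult_vec mult.assoc)
qed (rule mult_carrier_mat block_mat_carrier)+

lemma block_mat_one: "block_mat d 1 (0\<^sub>v d) (1\<^sub>m d) = 1\<^sub>m (Suc d)"
  by (rule eq_matI) (auto simp: block_mat_def split: nat.splits)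

lemma block_mat_inject:
  assumes "b \<in> carrier_vec d" "A \<in> carrier_mat d d" "b' \<in> carrier_vec d" "A' \<in> carrier_mat d d"
  shows "block_mat d c b A = block_mat d c' b' A' \<longleftrightarrow> c = c' \<and> b = b' \<and> A = A'"
proof
  assume eq: "block_mat d c b A = block_mat d c' b' A'"
  have *: "block_mat d c b A $$ (i, j) = block_mat d c' b' A' $$ (i, j)" for i j
    by (simp add: eq)
  have "b $ i = b' $ i" if "i < d" for i
    using *[of "Suc i" 0] that by (simp add: block_mat_def)
  moreover have "A $$ (i, j) = A' $$ (i, j)" if "i < d" "j < d" for i j
    using *[of "Suc i" "Suc j"] that by (simp add: block_mat_def)
  ultimately show "c = c' \<and> b = b' \<and> A = A'"
    using assms *[of 0 0] by (auto intro: eq_vecI eq_matI)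
qed auto

lemma block_matE:
  assumes "a \<in> carrier_mat (Suc d) (Suc d)" "\<And>j. j < d \<Longrightarrow> a $$ (0, Suc j) = 0"
  obtains c b A where "b \<in> carrier_vec d" "A \<in> carrier_mat d d" "a = block_mat d c b A"
proof -
  have "a = block_mat d (a $$ (0, 0)) (vec d (\<lambda>i. a $$ (Suc i, 0))) (mat d d (\<lambda>(i, j). a $$ (Suc i, Suc j)))"
    using assms by (intro eq_matI) (auto simp: block_mat_def split: nat.splits)
  then show thesis by (rule that[rotated 2]) auto
qed

lemma block_mat_GL:
  assumes "c \<noteq> 0" "b \<in> carrier_vec d" "A \<in> carrier (GL TYPE('a::field) d)"
  shows "block_mat d c b A \<in> carrier (GL TYPE('a) (Suc d))"
proof -
  obtain B where A: "A \<in> carrier_mat d d" and B: "B \<in> carrier_mat d d" "B * A = 1\<^sub>m d" "A * B = 1\<^sub>m d"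
    using assms(3) by (auto simp: carrier_GL)
  \<comment> \<open>Solves \<open>inverse c * b + A b' = 0\<close>, the condition that the lower
    left block of the product with the inverse vanishes.\<close>
  define b' where "b' = - inverse c \<cdot>\<^sub>v (B *\<^sub>v b)"
  have b': "b' \<in> carrier_vec d" using assms A B by (simp add: b'_def)
  have "A *\<^sub>v b' = - inverse c \<cdot>\<^sub>v b"
    using assms A B by (simp add: b'_def mult_mat_vec[of _ d d] flip: assoc_mult_mat_vec[of A d d B d])
  then have "block_mat d c b A * block_mat d (inverse c) b' B = 1\<^sub>m (Suc d)"
    using assms A B b' by (simp add: block_mat_mult flip: block_mat_one)
      (auto intro!: arg_cong2[where f = "block_mat d 1"])
  moreover have "block_mat d (inverse c) b' B * block_mat d c b A = 1\<^sub>m (Suc d)"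
    using assms A B b' by (simp add: block_mat_mult flip: block_mat_one)
      (auto intro!: arg_cong2[where f = "block_mat d 1"] simp: b'_def)
  ultimately show ?thesis
    unfolding carrier_GL by (intro conjI bexI[of _ "block_mat d (inverse c) b' B"]) auto
qed


section \<open>Diagonal matrices\<close>

lemma mat_diag_mult_vec:
  assumes "v \<in> carrier_vec m"
  shows "mat_diag m f *\<^sub>v v = vec m (\<lambda>i. f i * v $ i)"
  using assms
  by (intro eq_vecI) (auto simp: mat_diag_def scalar_prod_def if_distrib[of "\<lambda>x. x * _"] cong: if_cong)

lemma mat_diag_GL:
  assumes "\<And>i. i < m \<Longrightarrow> f i \<noteq> (0::'a::field)"
  shows "mat_diag m f \<in> carrier (GL TYPE('a) m)"
proof -
  have "mat_diag m (\<lambda>i. inverse (f i)) * mat_diag m f = 1\<^sub>m m"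
    "mat_diag m f * mat_diag m (\<lambda>i. inverse (f i)) = 1\<^sub>m m"
    unfolding mat_diag_diag using assms by (auto simp: mat_diag_def)
  then show ?thesis unfolding carrier_GL by (intro conjI bexI[of _ "mat_diag m (\<lambda>i. inverse (f i))"]) auto
qed

subsection \<open>The alternating trilinear form\<close>

lemma symplectic_form_add_left:
  assumes "u \<in> carrier_vec (2 * n)" "v \<in> carrier_vec (2 * n)"
  shows "symplectic_form n (u + v) w = symplectic_form n u w + symplectic_form n v w"
proof -
  have "symplectic_form n (u + v) w
      = (\<Sum>i<n. (u $ (2 * i) * w $ (2 * i + 1) - u $ (2 * i + 1) * w $ (2 * i))
        + (v $ (2 * i) * w $ (2 * i + 1) - v $ (2 * i + 1) * w $ (2 * i)))"
    unfolding symplectic_form_def using assms by (intro sum.cong) (auto simp: algebra_simps)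
  then show ?thesis by (simp add: symplectic_form_def sum.distrib)
qed

lemma symplectic_form_smult_left:
  assumes "u \<in> carrier_vec (2 * n)"
  shows "symplectic_form n (x \<cdot>\<^sub>v u) w = x * symplectic_form n u w"
  unfolding symplectic_form_def sum_distrib_left
  using assms by (intro sum.cong) (auto simp: algebra_simps)

lemma symplectic_form_swap: "symplectic_form n v u = - symplectic_form n u v"
  unfolding symplectic_form_def sum_negf[symmetric] by (intro sum.cong) auto

lemma symplectic_form_add_right:
  assumes "u \<in> carrier_vec (2 * n)" "v \<in> carrier_vec (2 * n)"
  shows "symplectic_form n w (u + v) = symplectic_form n w u + symplectic_form n w v"
  using symplectic_form_add_left[OF assms, of w] by (simp add: symplectic_form_swap[of n w])

lemma symplectic_form_smult_right:
  assumes "u \<in> carrier_vec (2 * n)"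
  shows "symplectic_form n w (x \<cdot>\<^sub>v u) = x * symplectic_form n w u"
  using symplectic_form_smult_left[OF assms, of x w] by (simp add: symplectic_form_swap[of n w])

lemmas symplectic_form_linear = symplectic_form_add_left symplectic_form_add_right
  symplectic_form_smult_left symplectic_form_smult_right

lemma symplectic_form_unit_vec:
  assumes "k < n"
  shows "symplectic_form n (unit_vec (2 * n) (2 * k)) w = w $ (2 * k + 1)"
    and "symplectic_form n (unit_vec (2 * n) (2 * k + 1)) w = - (w $ (2 * k))"
proof -
  have "symplectic_form n (unit_vec (2 * n) (2 * k)) w = (\<Sum>i<n. if k = i then w $ (2 * i + 1) else 0)"
    unfolding symplectic_form_def using assms by (intro sum.cong) auto
  then show "symplectic_form n (unit_vec (2 * n) (2 * k)) w = w $ (2 * k + 1)"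
    using assms by simp
  have "symplectic_form n (unit_vec (2 * n) (2 * k + 1)) w = (\<Sum>i<n. if k = i then - (w $ (2 * i)) else 0)"
    unfolding symplectic_form_def using assms by (intro sum.cong) auto
  then show "symplectic_form n (unit_vec (2 * n) (2 * k + 1)) w = - (w $ (2 * k))"
    using assms by simp
qed

text \<open>Every monomial of the form pairs one even with one odd coordinate, so scaling the even
  ones alone multiplies each monomial by \<open>c\<close> exactly once.\<close>

lemma symplectic_form_mat_diag:
  assumes "u \<in> carrier_vec (2 * n)" "v \<in> carrier_vec (2 * n)"
  shows "symplectic_form n (mat_diag (2 * n) (\<lambda>i. if even i then c else 1) *\<^sub>v u)
      (mat_diag (2 * n) (\<lambda>i. if even i then c else 1) *\<^sub>v v) = c * symplectic_form n u v"
  unfolding symplectic_form_def sum_distrib_left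
  using assms by (intro sum.cong) (auto simp: mat_diag_mult_vec algebra_simps)

text \<open>Dropping \<open>x_0\<close> lowers all indices by one: the pairs
  \<open>(2i-1, 2i)\<close> of the class become the pairs \<open>(2i-2, 2i-1)\<close> used by
  \<open>symplectic_form\<close>.\<close>

definition vec_tl :: "'a vec \<Rightarrow> 'a vec" where
  "vec_tl v = vec (dim_vec v - 1) (\<lambda>i. v $ Suc i)"

lemma vec_tl_vCons [simp]: "vec_tl (vCons x v) = v"
  by (rule eq_vecI) (auto simp: vec_tl_def)

text \<open>The value of the three-form \<Phi>. As \<Omega> is alternating, the three cyclic
  permutations suffice.\<close>

definition alt_form :: "nat \<Rightarrow> 'a::field vec \<Rightarrow> 'a vec \<Rightarrow> 'a vec \<Rightarrow> 'a" where
  "alt_form n u v w = u $ 0 * symplectic_form n (vec_tl v) (vec_tl w)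
     + v $ 0 * symplectic_form n (vec_tl w) (vec_tl u)
     + w $ 0 * symplectic_form n (vec_tl u) (vec_tl v)"

section \<open>Matrices preserving the alternating form\<close>

definition preserves_alt :: "nat \<Rightarrow> 'a::field mat \<Rightarrow> bool" where
  "preserves_alt n a \<longleftrightarrow>
    (\<forall>u\<in>carrier_vec (Suc (2 * n)). \<forall>v\<in>carrier_vec (Suc (2 * n)). \<forall>w\<in>carrier_vec (Suc (2 * n)).
      alt_form n (a *\<^sub>v u) (a *\<^sub>v v) (a *\<^sub>v w) = alt_form n u v w)"

lemma preserves_alt_one: "preserves_alt n (1\<^sub>m (Suc (2 * n)))"
  by (simp add: preserves_alt_def)

lemma preserves_alt_mult:
  assumes "a \<in> carrier_mat (Suc (2 * n)) (Suc (2 * n))" "b \<in> carrier_mat (Suc (2 * n)) (Suc (2 * n))"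
    and "preserves_alt n a" "preserves_alt n b"
  shows "preserves_alt n (a * b)"
  using assms by (auto simp: preserves_alt_def assoc_mult_mat_vec[OF assms(1,2)])

text \<open>Invariance under \<open>a\<close> is applied to the images under \<open>b\<close>. The
  inverse is given as a matrix and not as \<open>inv\<close>, so the lemma also serves outside the
  group.\<close>

lemma preserves_alt_inverse:
  fixes a b :: "'a::field mat"
  assumes "a \<in> carrier_mat (Suc (2 * n)) (Suc (2 * n))" "b \<in> carrier_mat (Suc (2 * n)) (Suc (2 * n))"
    and "preserves_alt n a" "a * b = 1\<^sub>m (Suc (2 * n))"
  shows "preserves_alt n b"
proof -
  have *: "a *\<^sub>v (b *\<^sub>v u) = u" if "u \<in> carrier_vec (Suc (2 * n))" for u
    using assoc_mult_mat_vec[OF assms(1,2) that] that assms(4) by simp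
  show ?thesis
    unfolding preserves_alt_def
  proof (intro ballI)
    fix u v w :: "'a vec"
    assume uvw: "u \<in> carrier_vec (Suc (2 * n))" "v \<in> carrier_vec (Suc (2 * n))" "w \<in> carrier_vec (Suc (2 * n))"
    show "alt_form n (b *\<^sub>v u) (b *\<^sub>v v) (b *\<^sub>v w) = alt_form n u v w"
      using assms(3)[unfolded preserves_alt_def, rule_format, of "b *\<^sub>v u" "b *\<^sub>v v" "b *\<^sub>v w"]
        uvw assms(2) by (simp add: *)
  qed
qed

text \<open>
  The contraction of the alternating form with \<open>v\<close> is a two-form, and it has rank at most two
  precisely when the coordinate \<open>v\<^sub>0\<close> vanishes. The Pluecker relation detects this.
\<close>

definition pluecker :: "nat \<Rightarrow> 'a::field vec \<Rightarrow> bool" where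
  "pluecker n v \<longleftrightarrow>
    (\<forall>q\<in>carrier_vec (Suc (2 * n)). \<forall>r\<in>carrier_vec (Suc (2 * n)).
     \<forall>s\<in>carrier_vec (Suc (2 * n)). \<forall>t\<in>carrier_vec (Suc (2 * n)).
      alt_form n v q r * alt_form n v s t - alt_form n v q s * alt_form n v r t
        + alt_form n v q t * alt_form n v r s = 0)"

text \<open>If \<open>v $ 0 = 0\<close>, the contraction is, up to sign, the wedge of
  \<open>x_0\<close> with the linear form \<open>\<Omega> (v, _)\<close>, hence decomposable.
  Otherwise its restriction to the hyperplane \<open>x_0 = 0\<close> is a nonzero multiple of
  \<Omega>, whose rank \<open>2 * n\<close> exceeds two because \<open>n > 1\<close>.\<close>

lemma pluecker_iff:
  fixes v :: "'a::field vec"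
  assumes "n > 1" "v \<in> carrier_vec (Suc (2 * n))"
  shows "pluecker n v \<longleftrightarrow> v $ 0 = 0"
proof
  assume P: "pluecker n v"
  define e :: "nat \<Rightarrow> 'a vec" where "e i = vCons 0 (unit_vec (2 * n) i)" for i
  have e: "e i \<in> carrier_vec (Suc (2 * n))" for i by (simp add: e_def)
  have alt: "alt_form n v (e i) (e j) = v $ 0 * symplectic_form n (unit_vec (2 * n) i) (unit_vec (2 * n) j)" for i j
    by (simp add: alt_form_def e_def)
  have sf: "symplectic_form n (unit_vec (2 * n) 0) w = w $ 1" "symplectic_form n (unit_vec (2 * n) 1) w = - (w $ 0)"
    "symplectic_form n (unit_vec (2 * n) 2) w = w $ 3" for w :: "'a vec"
    using assms(1) symplectic_form_unit_vec[of 0 n w] symplectic_form_unit_vec[of 1 n w]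
    by (simp_all add: numeral_3_eq_3)
  \<comment> \<open>The vectors \<open>e 0, e 1\<close> and \<open>e 2, e 3\<close> form two
    orthogonal hyperbolic pairs, so only the first product of the relation survives. The second pair
    exists because \<open>n > 1\<close>.\<close>
  have "v $ 0 * v $ 0 = 0"
    using P[unfolded pluecker_def, rule_format, OF e[of 0] e[of 1] e[of 2] e[of 3]] assms(1)
    by (simp add: alt sf)
  then show "v $ 0 = 0" by simp
next
  assume "v $ 0 = 0"
  then have alt: "alt_form n v q r = r $ 0 * symplectic_form n (vec_tl v) (vec_tl q)
      - q $ 0 * symplectic_form n (vec_tl v) (vec_tl r)" for q r
    by (simp add: alt_form_def symplectic_form_swap[of n "vec_tl r" "vec_tl v"])
  show "pluecker n v"
    unfolding pluecker_def alt by (simp add: algebra_simps)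
qed

text \<open>Contraction with the vector \<open>vCons 1 0\<close> yields the condition on
  \<open>A\<close>. Conversely, the contributions of \<open>b\<close> cancel in pairs since \<Omega>
  is alternating, so \<open>b\<close> remains arbitrary.\<close>

lemma preserves_alt_block_mat:
  assumes "b \<in> carrier_vec (2 * n)" "A \<in> carrier_mat (2 * n) (2 * n)"
  shows "preserves_alt n (block_mat (2 * n) c b A) \<longleftrightarrow>
    (\<forall>u\<in>carrier_vec (2 * n). \<forall>v\<in>carrier_vec (2 * n).
      c * symplectic_form n (A *\<^sub>v u) (A *\<^sub>v v) = symplectic_form n u v)" (is "?L \<longleftrightarrow> ?R")
proof
  assume L: ?L
  show ?R
  proof (intro ballI)
    fix u v :: "'a vec" assume "u \<in> carrier_vec (2 * n)" "v \<in> carrier_vec (2 * n)"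
    then show "c * symplectic_form n (A *\<^sub>v u) (A *\<^sub>v v) = symplectic_form n u v"
      using L[unfolded preserves_alt_def, rule_format, of "vCons 1 (0\<^sub>v (2 * n))" "vCons 0 u" "vCons 0 v"] assms
      by (simp add: block_mat_mult_vec alt_form_def symplectic_form_linear)
  qed
next
  assume R: ?R
  show ?L
    unfolding preserves_alt_def
  proof (intro ballI)
    fix u v w :: "'a vec"
    assume "u \<in> carrier_vec (Suc (2 * n))" "v \<in> carrier_vec (Suc (2 * n))" "w \<in> carrier_vec (Suc (2 * n))"
    then obtain x y z u' v' w' where [simp]: "u = vCons x u'" "v = vCons y v'" "w = vCons z w'"
      and uvw: "u' \<in> carrier_vec (2 * n)" "v' \<in> carrier_vec (2 * n)" "w' \<in> carrier_vec (2 * n)"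
      by (metis carrier_vec_SucE)
    have [simp]: "A *\<^sub>v u' \<in> carrier_vec (2 * n)" "A *\<^sub>v v' \<in> carrier_vec (2 * n)" "A *\<^sub>v w' \<in> carrier_vec (2 * n)"
      using assms uvw by simp_all
    have R': "symplectic_form n v' w' = c * symplectic_form n (A *\<^sub>v v') (A *\<^sub>v w')"
      "symplectic_form n w' u' = c * symplectic_form n (A *\<^sub>v w') (A *\<^sub>v u')"
      "symplectic_form n u' v' = c * symplectic_form n (A *\<^sub>v u') (A *\<^sub>v v')"
      using R uvw by simp_all
    have b: "symplectic_form n b b = 0" by (simp add: symplectic_form_def)
    show "alt_form n (block_mat (2 * n) c b A *\<^sub>v u) (block_mat (2 * n) c b A *\<^sub>v v)
        (block_mat (2 * n) c b A *\<^sub>v w) = alt_form n u v w"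
      using assms uvw
      by (simp add: block_mat_mult_vec alt_form_def symplectic_form_linear R' b
          symplectic_form_swap[of n "A *\<^sub>v _" b] algebra_simps)
  qed
qed

text \<open>The Pluecker condition is carried along by maps that preserve \<Phi>, so these map the
  hyperplane \<open>x_0 = 0\<close> into itself. Applied to the inverse matrix as well, this shows
  that both diagonal blocks are invertible.\<close>

lemma preserves_alt_block_matE:
  fixes a :: "'a::field mat"
  assumes "n > 1" "a \<in> carrier (GL TYPE('a) (Suc (2 * n)))" "preserves_alt n a"
  obtains c b A where "c \<noteq> 0" "b \<in> carrier_vec (2 * n)" "A \<in> carrier (GL TYPE('a) (2 * n))"
    "a = block_mat (2 * n) c b A"
proof -
  \<comment> \<open>Only a right inverse \<open>y\<close> is required, so that the claim applies to
    \<open>a\<close> and to its inverse alike.\<close>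
  have block: "\<exists>c b A. b \<in> carrier_vec (2 * n) \<and> A \<in> carrier_mat (2 * n) (2 * n) \<and> x = block_mat (2 * n) c b A"
    if x: "x \<in> carrier_mat (Suc (2 * n)) (Suc (2 * n))" "preserves_alt n x"
      and y: "y \<in> carrier_mat (Suc (2 * n)) (Suc (2 * n))" "x * y = 1\<^sub>m (Suc (2 * n))"
    for x y :: "'a mat"
  proof -
    have "x $$ (0, Suc j) = 0" if j: "j < 2 * n" for j
    proof -
      define e :: "'a vec" where "e = unit_vec (Suc (2 * n)) (Suc j)"
      have e: "e \<in> carrier_vec (Suc (2 * n))" "e $ 0 = 0" by (simp_all add: e_def unit_vec_def)
      have "pluecker n e" using pluecker_iff[OF assms(1) e(1)] e(2) by simp
      \<comment> \<open>Arbitrary test vectors are pulled back through \<open>y\<close>, which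
        reduces the relation for \<open>x e\<close> to the one for \<open>e\<close>.\<close>
      moreover have "alt_form n (x *\<^sub>v e) q r = alt_form n e (y *\<^sub>v q) (y *\<^sub>v r)"
        if "q \<in> carrier_vec (Suc (2 * n))" "r \<in> carrier_vec (Suc (2 * n))" for q r
        using x(2)[unfolded preserves_alt_def, rule_format, of e "y *\<^sub>v q" "y *\<^sub>v r"] that y e(1)
          assoc_mult_mat_vec[OF x(1) y(1) that(1)] assoc_mult_mat_vec[OF x(1) y(1) that(2)]
        by simp
      ultimately have "pluecker n (x *\<^sub>v e)"
        using y(1) unfolding pluecker_def by auto
      then have "(x *\<^sub>v e) $ 0 = 0" using pluecker_iff[OF assms(1), of "x *\<^sub>v e"] x e by auto
      then show ?thesis using x j by (simp add: e_def)
    qed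
    with x(1) show ?thesis by (metis block_matE)
  qed
  obtain a' where a: "a \<in> carrier_mat (Suc (2 * n)) (Suc (2 * n))"
    and a': "a' \<in> carrier_mat (Suc (2 * n)) (Suc (2 * n))" "a' * a = 1\<^sub>m (Suc (2 * n))" "a * a' = 1\<^sub>m (Suc (2 * n))"
    using assms(2) by (auto simp: carrier_GL)
  from block[OF a assms(3) a'(1,3)] obtain c b A
    where A: "b \<in> carrier_vec (2 * n)" "A \<in> carrier_mat (2 * n) (2 * n)" "a = block_mat (2 * n) c b A" by blast
  from block[OF a'(1) preserves_alt_inverse[OF a a'(1) assms(3) a'(3)] a a'(2)] obtain c' b' A'
    where A': "b' \<in> carrier_vec (2 * n)" "A' \<in> carrier_mat (2 * n) (2 * n)" "a' = block_mat (2 * n) c' b' A'" by blast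
  have "c * c' = 1" "A * A' = 1\<^sub>m (2 * n)" "A' * A = 1\<^sub>m (2 * n)"
    using a'(2,3) A A' by (auto simp: block_mat_mult block_mat_inject simp flip: block_mat_one)
  with A A' show thesis by (intro that[of c b A]) (auto simp: carrier_GL)
qed

subsection \<open>Cochains with values in the multiplicative group of a field\<close>

lemma mult_group_simps [simp]:
  "carrier (mult_group TYPE('k::field)) = - {0}"
  "monoid.mult (mult_group TYPE('k)) = (*)"
  "one (mult_group TYPE('k)) = 1"
proof -
  have "\<exists>y::'k. y * x = 1 \<and> x * y = 1" if "x \<noteq> 0" for x
    using that by (intro exI[of _ "inverse x"]) simp
  then show "carrier (mult_group TYPE('k)) = - {0}"
    by (auto simp: units_of_def Units_def)
qed (auto simp: units_of_def)

lemma comm_group_mult_group: "comm_group (mult_group TYPE('k::field))"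
proof (rule comm_groupI)
  fix x assume "x \<in> carrier (mult_group TYPE('k))"
  then show "\<exists>y\<in>carrier (mult_group TYPE('k)). y \<otimes>\<^bsub>mult_group TYPE('k)\<^esub> x = \<one>\<^bsub>mult_group TYPE('k)\<^esub>"
    by (intro bexI[of _ "inverse x"]) auto
qed auto

lemma inv_mult_group [simp]:
  assumes "x \<noteq> 0"
  shows "inv\<^bsub>mult_group TYPE('k::field)\<^esub> x = inverse x"
proof -
  interpret comm_group "mult_group TYPE('k)" by (rule comm_group_mult_group)
  show ?thesis by (rule inv_equality) (use assms in auto)
qed

section \<open>Cocycles, coboundaries and their cosets\<close>

lemma carrier_Z3_mult_group:
  "f \<in> carrier (Z3 G (mult_group TYPE('k::field))) \<longleftrightarrow>
     f \<in> extensional (carrier G \<times> carrier G \<times> carrier G)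
     \<and> (\<forall>g\<in>carrier G. \<forall>h\<in>carrier G. \<forall>k\<in>carrier G. f (g, h, k) \<noteq> 0)
     \<and> (\<forall>g\<in>carrier G. \<forall>h\<in>carrier G. \<forall>k\<in>carrier G. \<forall>l\<in>carrier G.
          f (h, k, l) * f (g, h \<otimes>\<^bsub>G\<^esub> k, l) * f (g, h, k) = f (g \<otimes>\<^bsub>G\<^esub> h, k, l) * f (g, h, k \<otimes>\<^bsub>G\<^esub> l))"
  by (auto simp: Z3_def PiE_def Pi_def)

lemma mult_Z3: "f \<otimes>\<^bsub>Z3 G (mult_group TYPE('k::field))\<^esub> f' = (\<lambda>x\<in>carrier G \<times> carrier G \<times> carrier G. f x * f' x)"
  and one_Z3: "\<one>\<^bsub>Z3 G (mult_group TYPE('k))\<^esub> = (\<lambda>x\<in>carrier G \<times> carrier G \<times> carrier G. 1)"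
  by (simp_all add: Z3_def)

lemma comm_group_Z3:
  fixes G (structure)
  assumes "group G"
  shows "comm_group (Z3 G (mult_group TYPE('k::field)))" (is "comm_group ?Z")
proof -
  interpret group G by fact
  show ?thesis
  proof (rule comm_groupI)
    fix f f' :: "'a \<times> 'a \<times> 'a \<Rightarrow> 'k"
    assume f: "f \<in> carrier ?Z" and f': "f' \<in> carrier ?Z"
    have "f (h, k, l) * f' (h, k, l) * (f (g, h \<otimes> k, l) * f' (g, h \<otimes> k, l)) * (f (g, h, k) * f' (g, h, k))
        = f (g \<otimes> h, k, l) * f' (g \<otimes> h, k, l) * (f (g, h, k \<otimes> l) * f' (g, h, k \<otimes> l))"
      if "g \<in> carrier G" "h \<in> carrier G" "k \<in> carrier G" "l \<in> carrier G" for g h k l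
    proof -
      have "(f (h, k, l) * f (g, h \<otimes> k, l) * f (g, h, k)) * (f' (h, k, l) * f' (g, h \<otimes> k, l) * f' (g, h, k))
          = (f (g \<otimes> h, k, l) * f (g, h, k \<otimes> l)) * (f' (g \<otimes> h, k, l) * f' (g, h, k \<otimes> l))"
        using f f' that by (simp add: carrier_Z3_mult_group)
      then show ?thesis by (simp add: ac_simps)
    qed
    with f f' show "f \<otimes>\<^bsub>?Z\<^esub> f' \<in> carrier ?Z"
      by (simp add: carrier_Z3_mult_group mult_Z3)
    show "f \<otimes>\<^bsub>?Z\<^esub> f' = f' \<otimes>\<^bsub>?Z\<^esub> f"
      by (simp add: mult_Z3 mult.commute)
    fix f'' :: "'a \<times> 'a \<times> 'a \<Rightarrow> 'k" 
    show "f \<otimes>\<^bsub>?Z\<^esub> f' \<otimes>\<^bsub>?Z\<^esub> f'' = f \<otimes>\<^bsub>?Z\<^esub> (f' \<otimes>\<^bsub>?Z\<^esub> f'')"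
      by (auto simp: mult_Z3 fun_eq_iff mult.assoc restrict_def)
  next
    show "\<one>\<^bsub>?Z\<^esub> \<in> carrier ?Z" by (simp add: carrier_Z3_mult_group one_Z3)
  next
    fix f assume f: "f \<in> carrier ?Z"
    then show "\<one>\<^bsub>?Z\<^esub> \<otimes>\<^bsub>?Z\<^esub> f = f"
      by (auto simp: carrier_Z3_mult_group mult_Z3 one_Z3 fun_eq_iff restrict_def extensional_def)
    define f' where "f' = (\<lambda>x\<in>carrier G \<times> carrier G \<times> carrier G. inverse (f x))"
    have "inverse (f (h, k, l)) * inverse (f (g, h \<otimes> k, l)) * inverse (f (g, h, k))
        = inverse (f (g \<otimes> h, k, l)) * inverse (f (g, h, k \<otimes> l))"
      if "g \<in> carrier G" "h \<in> carrier G" "k \<in> carrier G" "l \<in> carrier G" for g h k l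
    proof -
      have "f (h, k, l) * f (g, h \<otimes> k, l) * f (g, h, k) = f (g \<otimes> h, k, l) * f (g, h, k \<otimes> l)"
        using f that by (simp add: carrier_Z3_mult_group)
      then show ?thesis by (metis inverse_mult_distrib)
    qed
    with f have "f' \<in> carrier ?Z"
      by (simp add: carrier_Z3_mult_group f'_def)
    moreover have "f' \<otimes>\<^bsub>?Z\<^esub> f = \<one>\<^bsub>?Z\<^esub>"
      using f by (auto simp: f'_def mult_Z3 one_Z3 carrier_Z3_mult_group fun_eq_iff restrict_def)
    ultimately show "\<exists>f'\<in>carrier ?Z. f' \<otimes>\<^bsub>?Z\<^esub> f = \<one>\<^bsub>?Z\<^esub>" by blast
  qed
qed

text \<open>The formula of \<open>coboundary2\<close>, curried, with group inverses turned into
  division so that field arithmetic applies.\<close>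

definition cobd :: "('g, 'b) monoid_scheme \<Rightarrow> ('g \<times> 'g \<Rightarrow> 'k::field) \<Rightarrow> 'g \<Rightarrow> 'g \<Rightarrow> 'g \<Rightarrow> 'k" where
  "cobd G f g h k = f (h, k) / f (g \<otimes>\<^bsub>G\<^esub> h, k) * f (g, h \<otimes>\<^bsub>G\<^esub> k) / f (g, h)"

text \<open>A coboundary depends only on the values of its cochain on the carrier. Without
  extensionality of the cochain, witnesses can be given by plain formulas.\<close>

lemma B3_mult_group:
  assumes "group G"
  shows "B3 G (mult_group TYPE('k::field)) =
    {\<lambda>(g, h, k)\<in>carrier G \<times> carrier G \<times> carrier G. cobd G f g h k |f.
       \<forall>g\<in>carrier G. \<forall>h\<in>carrier G. f (g, h) \<noteq> 0}" (is "_ = ?B")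
proof -
  interpret group G by fact
  have eq: "coboundary2 G (mult_group TYPE('k)) f
      = (\<lambda>(g, h, k)\<in>carrier G \<times> carrier G \<times> carrier G. cobd G f g h k)"
    if "\<forall>g\<in>carrier G. \<forall>h\<in>carrier G. f (g, h) \<noteq> 0" for f
    using that by (auto simp: coboundary2_def cobd_def fun_eq_iff restrict_def divide_inverse)
  show ?thesis
  proof (intro equalityI subsetI)
    fix b assume "b \<in> B3 G (mult_group TYPE('k))"
    then obtain f where f: "f \<in> carrier G \<times> carrier G \<rightarrow>\<^sub>E - {0}" "b = coboundary2 G (mult_group TYPE('k)) f"
      by (auto simp: B3_def)
    moreover have "\<forall>g\<in>carrier G. \<forall>h\<in>carrier G. f (g, h) \<noteq> 0"
      using f(1) by (auto simp: PiE_def Pi_def)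
    ultimately show "b \<in> ?B" by (auto simp: eq)
  next
    fix b assume "b \<in> ?B"
    then obtain f where f: "\<forall>g\<in>carrier G. \<forall>h\<in>carrier G. f (g, h) \<noteq> 0"
      and b: "b = (\<lambda>(g, h, k)\<in>carrier G \<times> carrier G \<times> carrier G. cobd G f g h k)" by blast
    define f' where "f' = restrict f (carrier G \<times> carrier G)"
    have "b = coboundary2 G (mult_group TYPE('k)) f'"
      unfolding b by (subst eq) (use f in \<open>auto simp: f'_def cobd_def fun_eq_iff restrict_def\<close>)
    moreover have "f' \<in> carrier G \<times> carrier G \<rightarrow>\<^sub>E - {0}"
      using f by (auto simp: f'_def)
    ultimately show "b \<in> B3 G (mult_group TYPE('k))" by (auto simp: B3_def)
  qed
qed

text \<open>The coboundary is multiplicative in the cochain and its values are cocycles, so its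
  image is a subgroup.\<close>

lemma subgroup_B3:
  assumes "group G"
  shows "subgroup (B3 G (mult_group TYPE('k::field))) (Z3 G (mult_group TYPE('k)))" (is "subgroup ?B ?Z")
proof -
  interpret group G by fact
  interpret Z: comm_group ?Z by (rule comm_group_Z3) fact
  let ?d = "\<lambda>f. \<lambda>(g, h, k)\<in>carrier G \<times> carrier G \<times> carrier G. cobd G f g h k"
  let ?nz = "\<lambda>f::'a \<times> 'a \<Rightarrow> 'k. \<forall>g\<in>carrier G. \<forall>h\<in>carrier G. f (g, h) \<noteq> 0"
  have Z: "?d f \<in> carrier ?Z" if "?nz f" for f
    using that by (auto simp: carrier_Z3_mult_group cobd_def m_assoc)
  have mult: "?d f \<otimes>\<^bsub>?Z\<^esub> ?d f' = ?d (\<lambda>x. f x * f' x)" for f f'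
    by (auto simp: mult_Z3 cobd_def fun_eq_iff restrict_def ac_simps)
  have one: "?d (\<lambda>_. 1) = \<one>\<^bsub>?Z\<^esub>"
    by (auto simp: one_Z3 cobd_def fun_eq_iff restrict_def)
  show ?thesis
  proof (rule Z.subgroupI)
    show "?B \<subseteq> carrier ?Z" using Z by (auto simp: B3_mult_group[OF assms])
    show "?B \<noteq> {}" by (auto simp: B3_mult_group[OF assms] intro!: exI[of _ "\<lambda>_. 1"])
  next
    fix b assume "b \<in> ?B"
    then obtain f where f: "?nz f" "b = ?d f" by (auto simp: B3_mult_group[OF assms])
    let ?f' = "\<lambda>x. inverse (f x)"
    have "?d ?f' \<otimes>\<^bsub>?Z\<^esub> ?d f = ?d (\<lambda>_. 1)"
      unfolding mult using f(1) by (auto simp: fun_eq_iff cobd_def restrict_def)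
    then have "inv\<^bsub>?Z\<^esub> b = ?d ?f'"
      using f Z by (intro Z.inv_equality) (auto simp: one)
    then show "inv\<^bsub>?Z\<^esub> b \<in> ?B"
      using f(1) by (auto simp: B3_mult_group[OF assms] intro!: exI[of _ ?f'])
  next
    fix b b' assume "b \<in> ?B" "b' \<in> ?B"
    then obtain f f' where f: "?nz f" "b = ?d f" "?nz f'" "b' = ?d f'" by (auto simp: B3_mult_group[OF assms])
    have "b \<otimes>\<^bsub>?Z\<^esub> b' = ?d (\<lambda>x. f x * f' x)"
      using f(2,4) mult by simp
    moreover have "?nz (\<lambda>x. f x * f' x)" using f(1,3) by simp
    ultimately show "b \<otimes>\<^bsub>?Z\<^esub> b' \<in> ?B"
      by (auto simp: B3_mult_group[OF assms])
  qed
qed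

lemma mem_B3_coset:
  assumes "group G"
  shows "x \<in> B3 G (mult_group TYPE('k::field)) #>\<^bsub>Z3 G (mult_group TYPE('k))\<^esub> f \<longleftrightarrow>
    x \<in> extensional (carrier G \<times> carrier G \<times> carrier G) \<and>
    (\<exists>c. (\<forall>g\<in>carrier G. \<forall>h\<in>carrier G. c (g, h) \<noteq> 0) \<and>
      (\<forall>g\<in>carrier G. \<forall>h\<in>carrier G. \<forall>k\<in>carrier G. x (g, h, k) = cobd G c g h k * f (g, h, k)))"
    (is "?L \<longleftrightarrow> ?R")
proof
  assume ?L
  then obtain c where c: "\<forall>g\<in>carrier G. \<forall>h\<in>carrier G. c (g, h) \<noteq> 0"
    and x: "x = (\<lambda>(g, h, k)\<in>carrier G \<times> carrier G \<times> carrier G. cobd G c g h k) \<otimes>\<^bsub>Z3 G (mult_group TYPE('k))\<^esub> f"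
    by (auto simp: r_coset_def B3_mult_group[OF assms])
  show ?R
    by (intro conjI exI[of _ c] c) (auto simp: x mult_Z3)
next
  assume ?R
  then obtain c where x: "x \<in> extensional (carrier G \<times> carrier G \<times> carrier G)"
    and c: "\<forall>g\<in>carrier G. \<forall>h\<in>carrier G. c (g, h) \<noteq> 0"
      "\<forall>g\<in>carrier G. \<forall>h\<in>carrier G. \<forall>k\<in>carrier G. x (g, h, k) = cobd G c g h k * f (g, h, k)" by blast
  have "x = (\<lambda>(g, h, k)\<in>carrier G \<times> carrier G \<times> carrier G. cobd G c g h k) \<otimes>\<^bsub>Z3 G (mult_group TYPE('k))\<^esub> f"
    using x c(2) by (auto simp: mult_Z3 fun_eq_iff restrict_def extensional_def)
  with c(1) show ?L
    by (auto simp: r_coset_def B3_mult_group[OF assms])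
qed

text \<open>Over a cycle of the arguments the factors \<open>c (h, k)\<close> cancel against the
  factors \<open>c (g, h)\<close>. What is left involves a product of two arguments in
  \<open>G\<close>, and commutativity identifies these remaining factors for the even and the odd
  permutations.\<close>

lemma alternate_cobd:
  assumes "comm_group G" "\<forall>g\<in>carrier G. \<forall>h\<in>carrier G. c (g, h) \<noteq> (0::'k::field)"
    and "u \<in> carrier G" "v \<in> carrier G" "w \<in> carrier G"
  shows "cobd G c u v w * cobd G c v w u * cobd G c w u v = cobd G c u w v * cobd G c v u w * cobd G c w v u"
proof -
  interpret comm_group G by fact
  have "v \<otimes>\<^bsub>G\<^esub> u = u \<otimes>\<^bsub>G\<^esub> v" "w \<otimes>\<^bsub>G\<^esub> u = u \<otimes>\<^bsub>G\<^esub> w" "w \<otimes>\<^bsub>G\<^esub> v = v \<otimes>\<^bsub>G\<^esub> w"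
    using assms by (simp_all add: m_comm)
  then show ?thesis
    using assms by (simp add: cobd_def field_simps)
qed

subsection \<open>The character of the prime field\<close>

lemma powi_mod:
  fixes \<xi> :: "'k::field"
  assumes "\<xi> ^ p = 1" "p > 0"
  shows "\<xi> powi (x mod int p) = \<xi> powi x"
proof -
  have "\<xi> \<noteq> 0" using assms by (cases "\<xi> = 0") (auto simp: power_0_left)
  have "\<xi> powi x = \<xi> powi (int p * (x div int p) + x mod int p)" by simp
  also have "\<dots> = \<xi> powi (x mod int p)"
    using \<open>\<xi> \<noteq> 0\<close> assms by (subst power_int_add) (auto simp: power_int_mult)
  finally show ?thesis by simp
qed

text \<open>The additive character of the prime field attached to a root of unity; its values are
  those of \<open>wedge_cocycle\<close>.\<close>

definition chr :: "'k::field \<Rightarrow> 'p::prime_card mod_ring \<Rightarrow> 'k" where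
  "chr \<xi> x = \<xi> powi to_int_mod_ring x"

context
  fixes \<xi> :: "'k::field" and p :: nat
  assumes p: "CARD('p::prime_card) = p" and root: "\<xi> ^ p = 1"
begin

lemma chr_nonzero: "chr \<xi> (x :: 'p mod_ring) \<noteq> 0"
proof -
  have "\<xi> \<noteq> 0" using root p by (cases "\<xi> = 0") (auto simp: power_0_left)
  then show ?thesis by (simp add: chr_def)
qed

lemma chr_add: "chr \<xi> (x + y :: 'p mod_ring) = chr \<xi> x * chr \<xi> y"
proof -
  have "\<xi> \<noteq> 0" using root p by (cases "\<xi> = 0") (auto simp: power_0_left)
  moreover have "p > 0" using p by auto
  ultimately show ?thesis
    using powi_mod[OF root] by (simp add: chr_def to_int_mod_ring_add p power_int_add)
qed

lemma chr_0: "chr \<xi> (0 :: 'p mod_ring) = 1"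
  by (simp add: chr_def)

lemma chr_diff: "chr \<xi> (x - y :: 'p mod_ring) = chr \<xi> x / chr \<xi> y"
  using chr_add[of "x - y" y] chr_nonzero[of y] by (simp add: field_simps)

text \<open>The representative of \<open>x - y\<close> lies between \<open>0\<close> and
  \<open>p - 1\<close>, and in this range primitivity leaves only the exponent
  \<open>0\<close>.\<close>

lemma chr_eq_iff:
  assumes "\<forall>j. 0 < j \<and> j < p \<longrightarrow> \<xi> ^ j \<noteq> 1"
  shows "chr \<xi> (x :: 'p mod_ring) = chr \<xi> y \<longleftrightarrow> x = y"
proof
  assume "chr \<xi> x = chr \<xi> y"
  then have "chr \<xi> (x - y) = 1" using chr_nonzero[of y] by (simp add: chr_diff)
  define j where "j = nat (to_int_mod_ring (x - y))"
  have r: "to_int_mod_ring (x - y) \<in> {0..<int p}"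
    using range_to_int_mod_ring[where ?'a = 'p] p by blast
  then have "\<xi> ^ j = 1" "j < p"
    using \<open>chr \<xi> (x - y) = 1\<close> by (auto simp: j_def chr_def power_int_nonneg_exp)
  with assms have "j = 0" by auto
  with r have "to_int_mod_ring (x - y) = 0" by (simp add: j_def)
  then show "x = y" by (simp add: to_int_mod_ring_hom.hom_0_iff)
qed simp

text \<open>By additivity in each argument, both sides of the cocycle equation expand to the same
  four values of \<open>T\<close>.\<close>

lemma chr_cocycle:
  fixes T :: "'p mod_ring vec \<Rightarrow> 'p mod_ring vec \<Rightarrow> 'p mod_ring vec \<Rightarrow> 'p mod_ring"
  assumes "\<And>u u' v w. u \<in> carrier_vec m \<Longrightarrow> u' \<in> carrier_vec m \<Longrightarrow> v \<in> carrier_vec m \<Longrightarrow> w \<in> carrier_vec m \<Longrightarrow>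
      T (u + u') v w = T u v w + T u' v w"
    and "\<And>u v v' w. u \<in> carrier_vec m \<Longrightarrow> v \<in> carrier_vec m \<Longrightarrow> v' \<in> carrier_vec m \<Longrightarrow> w \<in> carrier_vec m \<Longrightarrow>
      T u (v + v') w = T u v w + T u v' w"
    and "\<And>u v w w'. u \<in> carrier_vec m \<Longrightarrow> v \<in> carrier_vec m \<Longrightarrow> w \<in> carrier_vec m \<Longrightarrow> w' \<in> carrier_vec m \<Longrightarrow>
      T u v (w + w') = T u v w + T u v w'"
  shows "(\<lambda>(u, v, w)\<in>carrier_vec m \<times> carrier_vec m \<times> carrier_vec m. chr \<xi> (T u v w))
    \<in> carrier (Z3 (monoid_vec TYPE('p mod_ring) m) (mult_group TYPE('k)))"
  using assms by (auto simp: carrier_Z3_mult_group monoid_vec_simps chr_nonzero chr_add)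

end


text \<open>
  Writing \<open>x \<otimes> R = x \<otimes> (R - x \<otimes> \<mu>) + x \<otimes> x \<otimes> \<mu>\<close> splits the trilinear form into a summand that is symmetric
  in its last two arguments and one that is symmetric in its first two. The coboundary of half the
  restriction to the diagonal of these two arguments is, up to sign, the respective summand.
\<close>

lemma biadditive_coboundary:
  fixes R :: "'v::plus \<Rightarrow> 'v \<Rightarrow> 'a::field"
  assumes two: "(2::'a) \<noteq> 0"
    and add: "x (u + v) = x u + x v" "\<mu> (v + w) = \<mu> v + \<mu> w"
      "R (v + w) (v + w) = R v v + R v w + (R w v + R w w)"
    and skew: "R v w - R w v = x v * \<mu> w - x w * \<mu> v" and add_x: "x (v + w) = x v + x w"
    and q: "\<And>u v. 2 * q u v = x u * (R v v - x v * \<mu> v) - x u * x u * \<mu> v"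
  shows "q v w - q (u + v) w + q u (v + w) - q u v = x u * R v w"
proof -
  have R: "R w v = R v w - x v * \<mu> w + x w * \<mu> v"
    using skew by (simp add: algebra_simps)
  \<comment> \<open>The identity is proved after doubling, so that \<open>q\<close> enters only
    through its division-free description.\<close>
  have "2 * (q v w - q (u + v) w + q u (v + w) - q u v)
      = 2 * q v w - 2 * q (u + v) w + 2 * q u (v + w) - 2 * q u v"
    by (simp add: algebra_simps)
  also have "\<dots> = 2 * (x u * R v w)"
    unfolding q add add_x R by (simp add: algebra_simps)
  finally have "2 * (q v w - q (u + v) w + q u (v + w) - q u v) = 2 * (x u * R v w)" .
  then show ?thesis using two by (simp only: mult_cancel_left) simp
qed

subsection \<open>The cocycle representing \<open>\<omega>\<^sub>D\<close>\<close>

text \<open>The form \<open>B\<close> whose antisymmetrization is \<Omega>, in coordinates that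
  still include \<open>x_0\<close>. The number \<open>r\<close> of summands is separate from the
  dimension to allow induction over the partial products of the class.\<close>

definition half_form :: "nat \<Rightarrow> 'a::field vec \<Rightarrow> 'a vec \<Rightarrow> 'a" where
  "half_form r v w = (\<Sum>i<r. v $ (2 * i + 1) * w $ (2 * i + 2))"

lemma half_form_add:
  assumes "u \<in> carrier_vec (Suc (2 * n))" "v \<in> carrier_vec (Suc (2 * n))" "r \<le> n"
  shows "half_form r (u + v) w = half_form r u w + half_form r v w"
    and "half_form r w (u + v) = half_form r w u + half_form r w v"
  unfolding half_form_def sum.distrib[symmetric] using assms
  by (auto intro!: sum.cong simp: algebra_simps)

definition cocycle_D :: "nat \<Rightarrow> nat \<Rightarrow> 'k::field \<Rightarrow>
    'p::prime_card mod_ring vec \<times> 'p mod_ring vec \<times> 'p mod_ring vec \<Rightarrow> 'k" where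
  "cocycle_D m r \<xi> = (\<lambda>(u, v, w)\<in>carrier_vec m \<times> carrier_vec m \<times> carrier_vec m.
     chr \<xi> (u $ 0 * half_form r v w))"

lemma group_vec: "group (monoid_vec TYPE('a::ab_group_add) m)"
  using comm_group_vec by (rule comm_group.axioms(2))

context
  fixes \<xi> :: "'k::field" and p :: nat
  assumes p: "CARD('p::prime_card) = p" and root: "\<xi> ^ p = 1"
begin

lemma cocycle_D_closed:
  assumes "r \<le> n"
  shows "(cocycle_D (Suc (2 * n)) r \<xi> :: 'p mod_ring vec \<times> _ \<Rightarrow> _)
    \<in> carrier (Z3 (monoid_vec TYPE('p mod_ring) (Suc (2 * n))) (mult_group TYPE('k)))"
  unfolding cocycle_D_def
  by (rule chr_cocycle[OF p root]) (use assms in \<open>simp_all add: half_form_add[of _ n] algebra_simps\<close>)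

lemma wedge_cocycle_closed:
  assumes "i < m" "j < m" "l < m"
  shows "(wedge_cocycle m \<xi> i j l :: 'p mod_ring vec \<times> _ \<Rightarrow> _)
    \<in> carrier (Z3 (monoid_vec TYPE('p mod_ring) m) (mult_group TYPE('k)))"
  unfolding wedge_cocycle_def chr_def[symmetric]
  by (rule chr_cocycle[OF p root]) (use assms in \<open>simp_all add: algebra_simps\<close>)

text \<open>Cosets multiply through their representatives, and multiplying values of
  \<open>chr\<close> adds the exponents. The dimension stays fixed while \<open>r\<close>
  grows.\<close>

lemma omega_D_partial:
  assumes "r \<le> n"
  shows "(\<Otimes>\<^bsub>H3_vec TYPE('p) TYPE('k) (Suc (2 * n))\<^esub>i\<in>{1..r}. wedge_class (Suc (2 * n)) \<xi> 0 (2 * i - 1) (2 * i))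
    = B3 (monoid_vec TYPE('p mod_ring) (Suc (2 * n))) (mult_group TYPE('k))
      #>\<^bsub>Z3 (monoid_vec TYPE('p mod_ring) (Suc (2 * n))) (mult_group TYPE('k))\<^esub> cocycle_D (Suc (2 * n)) r \<xi>"
    (is "_ = ?B #>\<^bsub>?Z\<^esub> _")
proof -
  interpret Z: comm_group ?Z by (rule comm_group_Z3) (rule group_vec)
  interpret B: subgroup ?B ?Z by (rule subgroup_B3) (rule group_vec)
  interpret N: normal ?B ?Z by (rule Z.subgroup_imp_normal) (rule B.subgroup_axioms)
  interpret H: comm_group "H3_vec TYPE('p) TYPE('k) (Suc (2 * n))"
    unfolding H3_def by (rule Z.abelian_FactGroup) (rule B.subgroup_axioms)
  let ?H = "H3_vec TYPE('p) TYPE('k) (Suc (2 * n))"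
  let ?w = "\<lambda>i. wedge_class (Suc (2 * n)) \<xi> 0 (2 * i - 1) (2 * i) :: ('p mod_ring vec \<times> _ \<Rightarrow> _) set"
  let ?c = "\<lambda>i. wedge_cocycle (Suc (2 * n)) \<xi> 0 (2 * i - 1) (2 * i) :: 'p mod_ring vec \<times> _ \<Rightarrow> _"
  have c: "?c i \<in> carrier ?Z" if "i \<in> {1..n}" for i
    using that by (intro wedge_cocycle_closed) auto
  have H: "?w i \<in> carrier ?H"
    if "i \<in> {1..n}" for i
    unfolding wedge_class_def H3_def carrier_FactGroup using c[OF that] by blast
  from assms show ?thesis
  proof (induction r)
    case 0
    have "cocycle_D (Suc (2 * n)) 0 \<xi> = \<one>\<^bsub>?Z\<^esub>"
      by (auto simp: cocycle_D_def half_form_def one_Z3 monoid_vec_simps chr_0[OF p root] fun_eq_iff restrict_def)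
    moreover have "\<one>\<^bsub>H3_vec TYPE('p) TYPE('k) (Suc (2 * n))\<^esub> = ?B" by (simp add: H3_def)
    ultimately show ?case
      using Z.coset_mult_one[OF B.subset] by simp
  next
    case (Suc r)
    \<comment> \<open>The factor with index \<open>Suc r\<close> contributes the summand
      \<open>i = r\<close> of \<open>half_form\<close>, whose index starts at \<open>0\<close>: both
      involve the coordinates \<open>2 * r + 1\<close> and \<open>2 * r + 2\<close>.\<close>
    have step: "?c (Suc r) \<otimes>\<^bsub>?Z\<^esub> cocycle_D (Suc (2 * n)) r \<xi> = cocycle_D (Suc (2 * n)) (Suc r) \<xi>"
      by (auto simp: wedge_cocycle_def cocycle_D_def mult_Z3 monoid_vec_simps fun_eq_iff restrict_def half_form_def
          algebra_simps chr_add[OF p root] simp flip: chr_def)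
    have "{1..Suc r} = insert (Suc r) {1..r}" by auto
    also have "finprod ?H ?w \<dots> = ?w (Suc r) \<otimes>\<^bsub>?H\<^esub> finprod ?H ?w {1..r}"
      by (rule H.finprod_insert) (use H H[of "Suc r"] Suc.prems in auto)
    also have "\<dots> = (?B #>\<^bsub>?Z\<^esub> ?c (Suc r)) <#>\<^bsub>?Z\<^esub> (?B #>\<^bsub>?Z\<^esub> cocycle_D (Suc (2 * n)) r \<xi>)"
      using Suc.IH Suc.prems by (simp add: H3_def wedge_class_def)
    also have "\<dots> = ?B #>\<^bsub>?Z\<^esub> cocycle_D (Suc (2 * n)) (Suc r) \<xi>"
      unfolding step[symmetric] by (rule N.rcos_sum[OF c cocycle_D_closed]) (use Suc.prems in auto)
    finally show ?case .
  qed
qed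

lemma omega_D_eq:
  "omega_D TYPE('p) n \<xi> = B3 (monoid_vec TYPE('p mod_ring) (Suc (2 * n))) (mult_group TYPE('k))
      #>\<^bsub>Z3 (monoid_vec TYPE('p mod_ring) (Suc (2 * n))) (mult_group TYPE('k))\<^esub> cocycle_D (Suc (2 * n)) n \<xi>"
  using omega_D_partial[of n n] by (simp add: omega_D_def)

lemma mem_omega_D:
  "x \<in> omega_D TYPE('p) n \<xi> \<longleftrightarrow>
    x \<in> extensional (carrier_vec (Suc (2 * n)) \<times> carrier_vec (Suc (2 * n)) \<times> carrier_vec (Suc (2 * n))) \<and>
    (\<exists>c. (\<forall>u\<in>carrier_vec (Suc (2 * n)). \<forall>v\<in>carrier_vec (Suc (2 * n)). c (u, v) \<noteq> 0) \<and>
      (\<forall>u\<in>carrier_vec (Suc (2 * n)). \<forall>v\<in>carrier_vec (Suc (2 * n)). \<forall>w\<in>carrier_vec (Suc (2 * n)).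
        x (u, v, w) = cobd (monoid_vec TYPE('p mod_ring) (Suc (2 * n))) c u v w * chr \<xi> (u $ 0 * half_form n v w)))"
  unfolding omega_D_eq mem_B3_coset[OF group_vec] by (simp add: monoid_vec_simps cocycle_D_def)

end

subsection \<open>The stabilizer\<close>

lemma symplectic_form_vec_tl:
  assumes "v \<in> carrier_vec (Suc (2 * n))" "w \<in> carrier_vec (Suc (2 * n))"
  shows "symplectic_form n (vec_tl v) (vec_tl w) = half_form n v w - half_form n w v"
  unfolding symplectic_form_def half_form_def sum_subtractf[symmetric]
  using assms by (intro sum.cong) (auto simp: vec_tl_def)

text \<open>The full antisymmetrization of the exponent of \<open>cocycle_D\<close>, sorted into
  even and odd permutations to match \<open>alternate_cobd\<close>.\<close>

lemma alt_form_eq: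
  assumes "u \<in> carrier_vec (Suc (2 * n))" "v \<in> carrier_vec (Suc (2 * n))" "w \<in> carrier_vec (Suc (2 * n))"
  shows "alt_form n u v w =
    (u $ 0 * half_form n v w + v $ 0 * half_form n w u + w $ 0 * half_form n u v)
    - (u $ 0 * half_form n w v + v $ 0 * half_form n u w + w $ 0 * half_form n v u)"
  using assms by (simp add: alt_form_def symplectic_form_vec_tl algebra_simps)

context
  fixes \<xi> :: "'k::field" and p n :: nat
  assumes p: "CARD('p::prime_card) = p" and root: "\<xi> ^ p = 1"
    and primitive: "\<forall>j. 0 < j \<and> j < p \<longrightarrow> \<xi> ^ j \<noteq> 1"
    and odd: "odd p" and n: "n > 1"
begin

text \<open>The pullback of \<open>cocycle_D\<close> differs from it by a coboundary, which
  disappears on antisymmetrizing. The character is then removed by its injectivity, since the root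
  of unity is primitive.\<close>

lemma preserves_alt_if_stabilizes:
  fixes a :: "'p mod_ring mat"
  assumes a: "a \<in> carrier_mat (Suc (2 * n)) (Suc (2 * n))"
    and stab: "\<And>\<omega>. \<omega> \<in> omega_D TYPE('p) n \<xi> \<Longrightarrow>
      pullback3 (monoid_vec TYPE('p mod_ring) (Suc (2 * n))) (\<lambda>v. a *\<^sub>v v) \<omega> \<in> omega_D TYPE('p) n \<xi>"
  shows "preserves_alt n a"
proof -
  let ?V = "carrier_vec (Suc (2 * n)) :: 'p mod_ring vec set"
  let ?G = "monoid_vec TYPE('p mod_ring) (Suc (2 * n))"
  let ?T = "\<lambda>u v w :: 'p mod_ring vec. u $ 0 * half_form n v w"
  have "cocycle_D (Suc (2 * n)) n \<xi> \<in> omega_D TYPE('p) n \<xi>"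
    unfolding mem_omega_D[OF p root]
    by (auto simp: cocycle_D_def cobd_def intro!: exI[of _ "\<lambda>_. 1"])
  from stab[OF this] obtain c where c: "\<forall>u\<in>?V. \<forall>v\<in>?V. c (u, v) \<noteq> 0"
    and eq: "\<forall>u\<in>?V. \<forall>v\<in>?V. \<forall>w\<in>?V.
      pullback3 ?G (\<lambda>v. a *\<^sub>v v) (cocycle_D (Suc (2 * n)) n \<xi>) (u, v, w) = cobd ?G c u v w * chr \<xi> (?T u v w)"
    unfolding mem_omega_D[OF p root] by blast
  have aV: "a *\<^sub>v u \<in> ?V" if "u \<in> ?V" for u using a that by simp
  have chr_a: "chr \<xi> (?T (a *\<^sub>v u) (a *\<^sub>v v) (a *\<^sub>v w)) = cobd ?G c u v w * chr \<xi> (?T u v w)"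
    if "u \<in> ?V" "v \<in> ?V" "w \<in> ?V" for u v w
    using eq[rule_format, OF that] that by (simp add: pullback3_def monoid_vec_simps cocycle_D_def aV)
  have c_nz: "cobd ?G c u v w \<noteq> 0" if "u \<in> ?V" "v \<in> ?V" "w \<in> ?V" for u v w
    using c that by (simp add: cobd_def monoid_vec_simps)
  have "alt_form n (a *\<^sub>v u) (a *\<^sub>v v) (a *\<^sub>v w) = alt_form n u v w"
    if u: "u \<in> ?V" and v: "v \<in> ?V" and w: "w \<in> ?V" for u v w
  proof -
    have alt: "cobd ?G c u v w * cobd ?G c v w u * cobd ?G c w u v
        = cobd ?G c u w v * cobd ?G c v u w * cobd ?G c w v u"
      by (rule alternate_cobd[OF comm_group_vec]) (use c u v w in \<open>simp_all add: monoid_vec_simps\<close>)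
    have "chr \<xi> (alt_form n (a *\<^sub>v u) (a *\<^sub>v v) (a *\<^sub>v w))
        = (cobd ?G c u v w * cobd ?G c v w u * cobd ?G c w u v)
          / (cobd ?G c u w v * cobd ?G c v u w * cobd ?G c w v u) * chr \<xi> (alt_form n u v w)"
      using u v w aV by (simp add: alt_form_eq chr_add[OF p root] chr_diff[OF p root] chr_a ac_simps)
    also have "\<dots> = chr \<xi> (alt_form n u v w)"
      using c_nz u v w by (simp add: alt)
    finally show ?thesis by (simp add: chr_eq_iff[OF p root primitive])
  qed
  then show ?thesis by (simp add: preserves_alt_def)
qed

text \<open>As \<open>a\<close> multiplies \<open>x_0\<close> by a scalar, the exponent changes by
  \<open>u $ 0 * R v w\<close> with \<open>R\<close> biadditive. Invariance of \<Phi> controls the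
  skew part of \<open>R\<close>, and \<open>biadditive_coboundary\<close> then writes the change as
  a coboundary.\<close>

lemma stabilizes_if_preserves_alt:
  fixes a :: "'p mod_ring mat"
  assumes a: "a \<in> carrier (GL TYPE('p mod_ring) (Suc (2 * n)))" and pres: "preserves_alt n a"
    and \<omega>: "\<omega> \<in> omega_D TYPE('p) n \<xi>"
  shows "pullback3 (monoid_vec TYPE('p mod_ring) (Suc (2 * n))) (\<lambda>v. a *\<^sub>v v) \<omega> \<in> omega_D TYPE('p) n \<xi>"
proof -
  let ?V = "carrier_vec (Suc (2 * n)) :: 'p mod_ring vec set"
  let ?G = "monoid_vec TYPE('p mod_ring) (Suc (2 * n))"
  let ?T = "\<lambda>u v w :: 'p mod_ring vec. u $ 0 * half_form n v w"
  have a_carrier: "a \<in> carrier_mat (Suc (2 * n)) (Suc (2 * n))" using a by (simp add: carrier_GL)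
  then have aV: "a *\<^sub>v u \<in> ?V" if "u \<in> ?V" for u using that by simp
  have a_add: "a *\<^sub>v (u + v) = a *\<^sub>v u + a *\<^sub>v v" if "u \<in> ?V" "v \<in> ?V" for u v
    using mult_add_distrib_mat_vec[OF a_carrier that] .
  have two: "(2 :: 'p mod_ring) \<noteq> 0"
  \<comment> \<open>Here the oddness of \<open>p\<close> enters: the cochain \<open>q\<close> below
    is divided by two.\<close>
  proof
    assume "(2 :: 'p mod_ring) = 0"
    then have "of_nat 2 = (0 :: 'p mod_ring)" by simp
    then have "CARD('p) dvd 2" by (rule of_nat_0_mod_ring_dvd)
    then have "p dvd 2" by (simp add: p)
    with odd p prime_card[where 'a = 'p] show False by (auto dest!: dvd_imp_le simp: le_Suc_eq numeral_2_eq_2)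
  qed
  obtain x where x: "\<And>u. u \<in> ?V \<Longrightarrow> (a *\<^sub>v u) $ 0 = x * u $ 0"
  proof -
    obtain x b A where b: "b \<in> carrier_vec (2 * n)" "A \<in> carrier (GL TYPE('p mod_ring) (2 * n))"
      "a = block_mat (2 * n) x b A"
      using preserves_alt_block_matE[OF n a pres] by metis
    have "(a *\<^sub>v u) $ 0 = x * u $ 0" if "u \<in> ?V" for u
      using that b by (elim carrier_vec_SucE) (auto simp: carrier_GL block_mat_mult_vec)
    with that show thesis .
  qed
  \<comment> \<open>The basis vector dual to \<open>x_0\<close>. Contracting \<Phi> with it returns
    \<Omega>.\<close>
  define e :: "'p mod_ring vec" where "e = vCons 1 (0\<^sub>v (2 * n))"
  have e: "e \<in> ?V" by (simp add: e_def)
  \<comment> \<open>The cross terms that appear when \<Phi> is contracted with \<open>a e\<close>: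
    up to the scalar \<open>x\<close>, the pairing of \<open>a e\<close> with \<open>a w\<close>
    under \<Omega>.\<close>
  define \<mu> where "\<mu> w = x * (half_form n (a *\<^sub>v e) (a *\<^sub>v w) - half_form n (a *\<^sub>v w) (a *\<^sub>v e))" for w
  define R where "R v w = x * half_form n (a *\<^sub>v v) (a *\<^sub>v w) - half_form n v w" for v w
  have skew: "R v w - R w v = v $ 0 * \<mu> w - w $ 0 * \<mu> v" if "v \<in> ?V" "w \<in> ?V" for v w
  proof -
    have "alt_form n (a *\<^sub>v e) (a *\<^sub>v v) (a *\<^sub>v w) = alt_form n e v w"
      using pres that e by (simp add: preserves_alt_def)
    moreover have "e $ 0 = 1" by (simp add: e_def)
    moreover have "half_form n e u = 0" "half_form n u e = 0" for u
      by (auto simp: half_form_def e_def intro!: sum.neutral)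
    ultimately show ?thesis
      using that e aV by (simp add: alt_form_eq x R_def \<mu>_def algebra_simps)
  qed
  define q where "q u v = (u $ 0 * (R v v - v $ 0 * \<mu> v) - u $ 0 * u $ 0 * \<mu> v) / 2" for u v
  have T: "?T (a *\<^sub>v u) (a *\<^sub>v v) (a *\<^sub>v w) = (q v w - q (u + v) w + q u (v + w) - q u v) + ?T u v w"
    if u: "u \<in> ?V" and v: "v \<in> ?V" and w: "w \<in> ?V" for u v w
  proof -
    have "q v w - q (u + v) w + q u (v + w) - q u v = u $ 0 * R v w"
      by (rule biadditive_coboundary[where \<mu> = \<mu> and x = "\<lambda>u. u $ 0"])
        (use u v w aV e two skew in \<open>simp_all add: q_def R_def \<mu>_def a_add half_form_add[of _ n] algebra_simps\<close>)
    then show ?thesis using u by (simp add: x R_def algebra_simps)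
  qed
  obtain c where c: "\<forall>u\<in>?V. \<forall>v\<in>?V. c (u, v) \<noteq> 0"
    and \<omega>_eq: "\<forall>u\<in>?V. \<forall>v\<in>?V. \<forall>w\<in>?V. \<omega> (u, v, w) = cobd ?G c u v w * chr \<xi> (?T u v w)"
    using \<omega> unfolding mem_omega_D[OF p root] by blast
  \<comment> \<open>Since \<open>a\<close> is additive, pulling back the old coboundary amounts to
    pulling back its cochain; the factor \<open>chr \<xi> (q u v)\<close> accounts for the change of
    the exponent.\<close>
  define c' where "c' = (\<lambda>(u, v). c (a *\<^sub>v u, a *\<^sub>v v) * chr \<xi> (q u v))"
  have "\<omega> (a *\<^sub>v u, a *\<^sub>v v, a *\<^sub>v w) = cobd ?G c' u v w * chr \<xi> (?T u v w)"
    if u: "u \<in> ?V" and v: "v \<in> ?V" and w: "w \<in> ?V" for u v w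
    unfolding \<omega>_eq[rule_format, OF aV[OF u] aV[OF v] aV[OF w]] T[OF u v w]
    using u v w
    by (simp add: cobd_def c'_def monoid_vec_simps a_add chr_add[OF p root] chr_diff[OF p root] ac_simps)
  moreover have "c' (u, v) \<noteq> 0" if "u \<in> ?V" "v \<in> ?V" for u v
    using c that aV by (simp add: c'_def chr_nonzero[OF p root])
  ultimately show ?thesis
    unfolding mem_omega_D[OF p root]
    by (intro conjI exI[of _ c']) (auto simp: pullback3_def monoid_vec_simps)
qed

lemma carrier_Stab_omega_D:
  "carrier (Stab TYPE('p mod_ring) (Suc (2 * n)) (omega_D TYPE('p) n \<xi>))
    = {a \<in> carrier (GL TYPE('p mod_ring) (Suc (2 * n))). preserves_alt n a}"
  using preserves_alt_if_stabilizes stabilizes_if_preserves_alt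
  by (auto simp: Stab_def carrier_GL)

end

section \<open>The group preserving the alternating form as a split extension\<close>

lemma group_preserves_alt:
  "group ((GL TYPE('a::field) (Suc (2 * n)))
    \<lparr>carrier := {a \<in> carrier (GL TYPE('a) (Suc (2 * n))). preserves_alt n a}\<rparr>)"
proof -
  interpret GL: group "GL TYPE('a) (Suc (2 * n))" by (rule group_GL)
  have "subgroup {a \<in> carrier (GL TYPE('a) (Suc (2 * n))). preserves_alt n a} (GL TYPE('a) (Suc (2 * n)))"
  proof (rule GL.subgroupI)
    show "{a \<in> carrier (GL TYPE('a) (Suc (2 * n))). preserves_alt n a} \<noteq> {}"
      using preserves_alt_one GL.one_closed by auto
  next
    fix a assume a: "a \<in> {a \<in> carrier (GL TYPE('a) (Suc (2 * n))). preserves_alt n a}"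
    let ?b = "inv\<^bsub>GL TYPE('a) (Suc (2 * n))\<^esub> a"
    have "?b \<in> carrier (GL TYPE('a) (Suc (2 * n)))" "a * ?b = 1\<^sub>m (Suc (2 * n))"
      using a GL.r_inv[of a] by auto
    then show "?b \<in> {a \<in> carrier (GL TYPE('a) (Suc (2 * n))). preserves_alt n a}"
      using a preserves_alt_inverse[of a n ?b] by (simp add: carrier_GL)
  next
    fix a b assume "a \<in> {a \<in> carrier (GL TYPE('a) (Suc (2 * n))). preserves_alt n a}"
      "b \<in> {a \<in> carrier (GL TYPE('a) (Suc (2 * n))). preserves_alt n a}"
    then show "a \<otimes>\<^bsub>GL TYPE('a) (Suc (2 * n))\<^esub> b \<in> {a \<in> carrier (GL TYPE('a) (Suc (2 * n))). preserves_alt n a}"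
      using preserves_alt_mult[of a n b] GL.m_closed[of a b] by (auto simp: carrier_GL)
  qed auto
  then show ?thesis by (rule GL.subgroup_imp_group)
qed

lemma AffSp_simps:
  "carrier (AffSp TYPE('a::field) n) = carrier_vec (2 * n) \<times> Sp_set TYPE('a) n"
  "(b, A) \<otimes>\<^bsub>AffSp TYPE('a) n\<^esub> (b', A') = (b + A *\<^sub>v b', A * A')"
  by (auto simp: Aff_def semidirect_def monoid_vec_simps)

lemma Sp_set_mult:
  assumes "A \<in> Sp_set TYPE('a::field) n" "B \<in> Sp_set TYPE('a) n"
  shows "A * B \<in> Sp_set TYPE('a) n"
proof -
  interpret GL: group "GL TYPE('a) (2 * n)" by (rule group_GL)
  have AB: "A \<in> carrier_mat (2 * n) (2 * n)" "B \<in> carrier_mat (2 * n) (2 * n)"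
    using assms by (auto simp: Sp_set_def carrier_GL)
  then have "A * B *\<^sub>v v = A *\<^sub>v (B *\<^sub>v v)" if "v \<in> carrier_vec (2 * n)" for v
    using assoc_mult_mat_vec that by blast
  then show ?thesis
    using assms AB GL.m_closed[of A B] by (auto simp: Sp_set_def)
qed

text \<open>The projection reads off the scalar \<open>c\<close> in the corner. On its kernel
  \<open>c = 1\<close>, so \<open>A\<close> is symplectic and \<open>b\<close> is free, and the
  lower left block of a product is \<open>b + A b'\<close>, as in the affine group.\<close>

lemma preserves_alt_semidirect:
  assumes n: "n > 1" and E: "E = (GL TYPE('a::field) (Suc (2 * n)))
    \<lparr>carrier := {a \<in> carrier (GL TYPE('a) (Suc (2 * n))). preserves_alt n a}\<rparr>"
  shows "\<exists>\<phi> \<in> hom (mult_group TYPE('a)) (AutoGroup (AffSp TYPE('a) n)).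
    E \<cong> semidirect (AffSp TYPE('a) n) (mult_group TYPE('a)) \<phi>"
proof (rule split_extension_iso_semidirect)
  let ?b = "block_mat (2 * n) :: 'a \<Rightarrow> 'a vec \<Rightarrow> 'a mat \<Rightarrow> 'a mat"
  \<comment> \<open>Only one coordinate of each hyperbolic pair is rescaled. A scalar matrix would
    require a square root of \<open>c\<close>, whereas this choice exists for all \<open>c\<close>
    and is multiplicative in it.\<close>
  let ?D = "\<lambda>c::'a. mat_diag (2 * n) (\<lambda>i. if even i then inverse c else 1)"
  have E_simps: "carrier E = {a \<in> carrier (GL TYPE('a) (Suc (2 * n))). preserves_alt n a}"
    "a \<otimes>\<^bsub>E\<^esub> a' = a * a'" "\<one>\<^bsub>E\<^esub> = 1\<^sub>m (Suc (2 * n))" for a a'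
    by (simp_all add: E)
  have blockE: "\<exists>c b A. c \<noteq> 0 \<and> b \<in> carrier_vec (2 * n) \<and> A \<in> carrier (GL TYPE('a) (2 * n)) \<and> a = ?b c b A"
    if "a \<in> carrier E" for a
    using that preserves_alt_block_matE[OF n, of a] unfolding E_simps by blast
  show "group E" unfolding E by (rule group_preserves_alt)
  show "group (mult_group TYPE('a))" using comm_group_mult_group by (rule comm_group.axioms(2))
  show "(\<lambda>a. a $$ (0, 0)) \<in> hom E (mult_group TYPE('a))"
  proof (rule homI)
    fix a assume "a \<in> carrier E"
    from blockE[OF this] obtain c b A where a: "c \<noteq> 0" "b \<in> carrier_vec (2 * n)" "A \<in> carrier_mat (2 * n) (2 * n)"
      "a = ?b c b A" by (auto simp: carrier_GL)
    then show "a $$ (0, 0) \<in> carrier (mult_group TYPE('a))" by simp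
    fix a' assume "a' \<in> carrier E"
    from blockE[OF this] obtain c' b' A' where "c' \<noteq> 0" "b' \<in> carrier_vec (2 * n)" "A' \<in> carrier_mat (2 * n) (2 * n)"
      "a' = ?b c' b' A'" by (auto simp: carrier_GL)
    with a show "(a \<otimes>\<^bsub>E\<^esub> a') $$ (0, 0) = a $$ (0, 0) \<otimes>\<^bsub>mult_group TYPE('a)\<^esub> a' $$ (0, 0)"
      by (simp add: E_simps block_mat_mult)
  qed
  txt \<open>\<^term>\<open>?D c\<close> rescales the symplectic form by \<open>1 / c\<close>, compensating the factor \<open>c\<close> by which the
    block matrix multiplies \<open>x\<^sub>0\<close>.\<close>
  show "(\<lambda>c. ?b c (0\<^sub>v (2 * n)) (?D c)) \<in> hom (mult_group TYPE('a)) E"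
  proof (rule homI)
    fix c assume "c \<in> carrier (mult_group TYPE('a))"
    then have c: "c \<noteq> 0" by simp
    then have "?D c \<in> carrier (GL TYPE('a) (2 * n))" by (intro mat_diag_GL) auto
    then show "?b c (0\<^sub>v (2 * n)) (?D c) \<in> carrier E"
      using c by (simp add: E_simps block_mat_GL preserves_alt_block_mat symplectic_form_mat_diag)
    fix c' assume "c' \<in> carrier (mult_group TYPE('a))"
    have zero: "?D c *\<^sub>v 0\<^sub>v (2 * n) = 0\<^sub>v (2 * n)" "c' \<cdot>\<^sub>v 0\<^sub>v (2 * n) = 0\<^sub>v (2 * n)"
      by (auto simp: mat_diag_mult_vec)
    have "?D (c * c') = mat_diag (2 * n) (\<lambda>i. (if even i then inverse c else 1) * (if even i then inverse c' else 1))"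
      by (rule arg_cong[of _ _ "mat_diag (2 * n)"]) auto
    then have D: "?D (c * c') = ?D c * ?D c'" by simp
    show "?b (c \<otimes>\<^bsub>mult_group TYPE('a)\<^esub> c') (0\<^sub>v (2 * n)) (?D (c \<otimes>\<^bsub>mult_group TYPE('a)\<^esub> c'))
        = ?b c (0\<^sub>v (2 * n)) (?D c) \<otimes>\<^bsub>E\<^esub> ?b c' (0\<^sub>v (2 * n)) (?D c')"
      unfolding mult_group_simps D by (simp add: E_simps block_mat_mult zero del: mat_diag_diag)
  qed
  show "?b c (0\<^sub>v (2 * n)) (?D c) $$ (0, 0) = c" for c by simp
  have Sp_GL: "A \<in> carrier (GL TYPE('a) (2 * n))" if "A \<in> Sp_set TYPE('a) n" for A
    using that by (simp add: Sp_set_def)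
  have Sp_carrier: "A \<in> carrier_mat (2 * n) (2 * n)" if "A \<in> Sp_set TYPE('a) n" for A
    using that by (simp add: Sp_set_def carrier_GL)
  show "x \<otimes>\<^bsub>AffSp TYPE('a) n\<^esub> y \<in> carrier (AffSp TYPE('a) n)"
    if "x \<in> carrier (AffSp TYPE('a) n)" "y \<in> carrier (AffSp TYPE('a) n)" for x y
    using that by (cases x; cases y) (auto simp: AffSp_simps Sp_set_mult intro!: add_carrier_vec mult_mat_vec_carrier Sp_carrier)
  \<comment> \<open>For \<open>c = 1\<close> the block criterion becomes invariance of \<Omega>
    under \<open>A\<close>, whatever the translation \<open>b\<close>. This gives both inclusions
    between the kernel and the image of the affine group.\<close>
  have block_Sp: "?b 1 b A \<in> carrier E \<longleftrightarrow> A \<in> Sp_set TYPE('a) n"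
    if "b \<in> carrier_vec (2 * n)" "A \<in> carrier (GL TYPE('a) (2 * n))" for b A
    using that block_mat_GL[of 1 b "2 * n" A]
    by (simp add: E_simps Sp_set_def preserves_alt_block_mat carrier_GL)
  show "(\<lambda>(b, A). ?b 1 b A) \<in> hom (AffSp TYPE('a) n) E"
  proof (rule homI)
    fix x assume x: "x \<in> carrier (AffSp TYPE('a) n)"
    then show "(case x of (b, A) \<Rightarrow> ?b 1 b A) \<in> carrier E"
      using block_Sp Sp_GL by (auto simp: AffSp_simps)
    fix y assume "y \<in> carrier (AffSp TYPE('a) n)"
    with x show "(case x \<otimes>\<^bsub>AffSp TYPE('a) n\<^esub> y of (b, A) \<Rightarrow> ?b 1 b A)
        = (case x of (b, A) \<Rightarrow> ?b 1 b A) \<otimes>\<^bsub>E\<^esub> (case y of (b, A) \<Rightarrow> ?b 1 b A)"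
      by (cases x; cases y) (simp add: AffSp_simps Sp_carrier E_simps block_mat_mult)
  qed
  show "inj_on (\<lambda>(b, A). ?b 1 b A) (carrier (AffSp TYPE('a) n))"
    by (auto simp: inj_on_def AffSp_simps Sp_carrier block_mat_inject)
  show "(\<lambda>(b, A). ?b 1 b A) ` carrier (AffSp TYPE('a) n) = kernel E (mult_group TYPE('a)) (\<lambda>a. a $$ (0, 0))"
  proof (intro equalityI subsetI)
    fix a assume "a \<in> (\<lambda>(b, A). ?b 1 b A) ` carrier (AffSp TYPE('a) n)"
    then show "a \<in> kernel E (mult_group TYPE('a)) (\<lambda>a. a $$ (0, 0))"
      using block_Sp Sp_GL by (auto simp: kernel_def AffSp_simps)
  next
    fix a assume a: "a \<in> kernel E (mult_group TYPE('a)) (\<lambda>a. a $$ (0, 0))"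
    then have "a \<in> carrier E" by (simp add: kernel_def)
    from blockE[OF this] obtain c b A where A: "b \<in> carrier_vec (2 * n)" "A \<in> carrier (GL TYPE('a) (2 * n))"
      "a = ?b c b A" by blast
    moreover have "c = 1" using a A(3) by (simp add: kernel_def)
    ultimately show "a \<in> (\<lambda>(b, A). ?b 1 b A) ` carrier (AffSp TYPE('a) n)"
      using block_Sp \<open>a \<in> carrier E\<close> by (auto simp: AffSp_simps image_iff intro!: bexI[of _ "(b, A)"])
  qed
qed

theorem proposition6p3:
  fixes p n :: nat and \<xi> :: "'k::{alg_closed_field, field_char_0}"
  assumes "CARD('p::prime_card) = p" and "prime p" and "odd p"
    and "n > 1"
    and "\<xi> ^ p = 1" and "\<forall>j. 0 < j \<and> j < p \<longrightarrow> \<xi> ^ j \<noteq> 1"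
  shows "\<exists>\<phi> \<in> hom (mult_group TYPE('p mod_ring)) (AutoGroup (AffSp TYPE('p mod_ring) n)).
    Stab TYPE('p mod_ring) (2 * n + 1) (omega_D TYPE('p) n \<xi>)
      \<cong> semidirect (AffSp TYPE('p mod_ring) n) (mult_group TYPE('p mod_ring)) \<phi>"
proof (rule preserves_alt_semidirect[OF assms(4)])
  show "Stab TYPE('p mod_ring) (2 * n + 1) (omega_D TYPE('p) n \<xi>) = (GL TYPE('p mod_ring) (Suc (2 * n)))
    \<lparr>carrier := {a \<in> carrier (GL TYPE('p mod_ring) (Suc (2 * n))). preserves_alt n a}\<rparr>"
    using carrier_Stab_omega_D[OF assms(1,5,6,3,4)] by (simp add: Stab_def)
qed

end
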